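(* Assume the hypotheses (i)–(iii) of the setting below, let $\overline A$ be $J$-m-dissipative, and let $\mathcal L^+$ be an $\overline A$-invariant maximal nonnegative subspace such that the spectrum of $A_+=\overline A|_{\mathcal L^+}$ lies in the closed left half-plane. Suppose in addition one of the following holds: (a) for some $\mu\in\mathbb C^-$ the closure $\overline S(\mu)$ of $S(\mu)=A_{11}-A_{12}(A_{22}-\mu)^{-1}A_{21}$ generates a quasi-holomorphic semigroup in $\mathcal H^+$; (b) $A_{11}$ generates a quasi-holomorphic semigroup in $\mathcal H^+$, and $A_{21}(A_{11}-\alpha_0)^{-1}$ is bounded for some $\alpha_0$ with $\operatorname{Re}\alpha_0>0$. Then $A_+$ generates a quasi-holomorphic semigroup in $\mathcal L^+$.
   Context: Setting: $\mathcal H$ is a separable Hilbert space with complementary orthogonal projections $P_\pm$ of infinite rank, $J=P_+-P_-$, $\mathcal H^\pm=P_\pm\mathcal H$, $[x,y]=(Jx,y)$. $A$ has dense domain $\mathcal D^+\oplus\mathcal D^-$, $\mathcal D^\pm\subset\mathcal H^\pm$, blocks $A_{11}=P_+A|_{\mathcal D^+}$, $A_{12}=P_+A|_{\mathcal D^-}$, $A_{21}=P_-A|_{\mathcal D^+}$, $A_{22}=P_-A|_{\mathcal D^-}$ ($A_{22}$ an operator in $\mathcal H^-$), and $JA$ is dissipative. Hypotheses: (i) $-A_{22}$ is m-dissipative in $\mathcal H^-$; (ii) $F(\mu)=(A_{22}-\mu)^{-1}A_{21}$ is bounded on $\mathcal D^+$ for $\mu\in\mathbb C^-=\{\operatorname{Re}\mu<0\}$;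 (iii) $G(\mu)=A_{12}(A_{22}-\mu)^{-1}$ is compact for $\mu\in\mathbb C^-$. $\overline A$ is the closure of $A$. An operator $T$ is dissipative if $\operatorname{Re}(Tx,x)\le0$ on $\mathcal D(T)$, m-dissipative if moreover $T-\lambda$ is boundedly invertible for $\operatorname{Re}\lambda>0$; $A$ is $J$-m-dissipative if $JA$ is m-dissipative. A subspace $\mathcal L$ is maximal nonnegative if $[x,x]\ge0$ on $\mathcal L$ and it has no proper extension with this property; it is $\overline A$-invariant if $\mathcal D(\overline A)\cap\mathcal L$ is dense in $\mathcal L$ and $\overline Ax\in\mathcal L$ for $x\in\mathcal D(\overline A)\cap\mathcal L$; $\overline A|_{\mathcal L}$ has domain $\mathcal D(\overline A)\cap\mathcal L$. A closed densely defined $T$ generates a quasi-holomorphic semigroup if for each $\varepsilon>0$, $\{\operatorname{Re}\lambda>\varepsilon\}\subset\rho(T)$ and there is $C_\varepsilon$ with $\|(T-\lambda)^{-1}\|\le C_\varepsilon|\lambda|^{-1}$ for all $\operatorname{Re}\lambda>\varepsilon$. *)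

theory Defs
  imports "HOL-Analysis.Analysis"
begin

class complex_vec = real_vector +
  fixes scaleC :: "complex \<Rightarrow> 'a \<Rightarrow> 'a"
  assumes scaleC_add_right: "scaleC a (x + y) = scaleC a x + scaleC a y"
    and scaleC_add_left: "scaleC (a + b) x = scaleC a x + scaleC b x"
    and scaleC_scaleC: "scaleC a (scaleC b x) = scaleC (a * b) x"
    and scaleC_one: "scaleC 1 x = x"
    and scaleR_scaleC: "scaleR r x = scaleC (complex_of_real r) x"

class chilbert = complex_vec + real_normed_vector + complete_space +
  fixes cinner :: "'a \<Rightarrow> 'a \<Rightarrow> complex"
  assumes cinner_add_left: "cinner (x + y) z = cinner x z + cinner y z"
    and cinner_scaleC_left: "cinner (scaleC a x) y = a * cinner x y"
    and cinner_commute: "cinner y x = cnj (cinner x y)"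
    and norm_eq_sqrt_cinner: "norm x = sqrt (Re (cinner x x))"

definition csubspace :: "'a::complex_vec set \<Rightarrow> bool" where
  "csubspace S \<longleftrightarrow> 0 \<in> S \<and> (\<forall>x\<in>S. \<forall>y\<in>S. x + y \<in> S) \<and> (\<forall>c. \<forall>x\<in>S. scaleC c x \<in> S)"

definition clinear_on :: "'a::complex_vec set \<Rightarrow> ('a \<Rightarrow> 'b::complex_vec) \<Rightarrow> bool" where
  "clinear_on D T \<longleftrightarrow> csubspace D \<and> (\<forall>x\<in>D. \<forall>y\<in>D. T (x + y) = T x + T y)
     \<and> (\<forall>c. \<forall>x\<in>D. T (scaleC c x) = scaleC c (T x))"

definition cspan :: "'a::complex_vec set \<Rightarrow> 'a set" where
  "cspan B = {(\<Sum>b\<in>F. scaleC (c b) b) | c F. finite F \<and> F \<subseteq> B}"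

definition orth_proj :: "('a::chilbert \<Rightarrow> 'a) \<Rightarrow> bool" where
  "orth_proj P \<longleftrightarrow> clinear_on UNIV P \<and> (\<forall>x. P (P x) = P x) \<and> (\<forall>x y. cinner (P x) y = cinner x (P y))"

definition infinite_rank :: "('a::complex_vec \<Rightarrow> 'a) \<Rightarrow> bool" where
  "infinite_rank P \<longleftrightarrow> \<not> (\<exists>B. finite B \<and> range P \<subseteq> cspan B)"

section \<open>Unbounded operators, given by a domain set D and a function T\<close>

definition op_graph :: "'a set \<Rightarrow> ('a \<Rightarrow> 'b) \<Rightarrow> ('a \<times> 'b) set" where
  "op_graph D T = {(x, T x) | x. x \<in> D}"

definition closed_op :: "'a::topological_space set \<Rightarrow> ('a \<Rightarrow> 'b::topological_space) \<Rightarrow> bool" where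
  "closed_op D T \<longleftrightarrow> closed (op_graph D T)"

definition closure_dom :: "'a::topological_space set \<Rightarrow> ('a \<Rightarrow> 'b::topological_space) \<Rightarrow> 'a set" where
  "closure_dom D T = {x. \<exists>y. (x, y) \<in> closure (op_graph D T)}"

definition closure_fun :: "'a::topological_space set \<Rightarrow> ('a \<Rightarrow> 'b::topological_space) \<Rightarrow> 'a \<Rightarrow> 'b" where
  "closure_fun D T = (\<lambda>x. SOME y. (x, y) \<in> closure (op_graph D T))"

definition in_resolvent :: "'a::chilbert set \<Rightarrow> 'a set \<Rightarrow> ('a \<Rightarrow> 'a) \<Rightarrow> complex \<Rightarrow> bool" where
  "in_resolvent X D T l \<longleftrightarrow> bij_betw (\<lambda>x. T x - scaleC l x) D X
     \<and> (\<exists>C. \<forall>x\<in>D. norm x \<le> C * norm (T x - scaleC l x))"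

definition res :: "'a::chilbert set \<Rightarrow> ('a \<Rightarrow> 'a) \<Rightarrow> complex \<Rightarrow> 'a \<Rightarrow> 'a" where
  "res D T l = the_inv_into D (\<lambda>x. T x - scaleC l x)"

definition dissipative_op :: "'a::chilbert set \<Rightarrow> ('a \<Rightarrow> 'a) \<Rightarrow> bool" where
  "dissipative_op D T \<longleftrightarrow> (\<forall>x\<in>D. Re (cinner (T x) x) \<le> 0)"

definition m_dissipative :: "'a::chilbert set \<Rightarrow> 'a set \<Rightarrow> ('a \<Rightarrow> 'a) \<Rightarrow> bool" where
  "m_dissipative X D T \<longleftrightarrow> clinear_on D T \<and> D \<subseteq> X \<and> T ` D \<subseteq> X \<and> dissipative_op D T
     \<and> (\<forall>l. 0 < Re l \<longrightarrow> in_resolvent X D T l)"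

definition bounded_on :: "'a::real_normed_vector set \<Rightarrow> ('a \<Rightarrow> 'b::real_normed_vector) \<Rightarrow> bool" where
  "bounded_on D F \<longleftrightarrow> (\<exists>C. \<forall>x\<in>D. norm (F x) \<le> C * norm x)"

definition compact_op :: "'a::real_normed_vector set \<Rightarrow> ('a \<Rightarrow> 'b::real_normed_vector) \<Rightarrow> bool" where
  "compact_op X G \<longleftrightarrow> (\<forall>B. B \<subseteq> X \<and> bounded B \<longrightarrow> compact (closure (G ` B)))"

definition generates_qh_semigroup :: "'a::chilbert set \<Rightarrow> 'a set \<Rightarrow> ('a \<Rightarrow> 'a) \<Rightarrow> bool" where
  "generates_qh_semigroup X D T \<longleftrightarrow> clinear_on D T \<and> D \<subseteq> X \<and> X \<subseteq> closure D \<and> T ` D \<subseteq> X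
     \<and> closed_op D T
     \<and> (\<forall>\<epsilon>>0. (\<forall>l. \<epsilon> < Re l \<longrightarrow> in_resolvent X D T l)
          \<and> (\<exists>C. \<forall>l. \<epsilon> < Re l \<longrightarrow> (\<forall>x\<in>D. cmod l * norm x \<le> C * norm (T x - scaleC l x))))"

definition Jop :: "('a::chilbert \<Rightarrow> 'a) \<Rightarrow> 'a \<Rightarrow> 'a" where
  "Jop P x = P x - (x - P x)"

definition nonneg_subspace :: "('a::chilbert \<Rightarrow> 'a) \<Rightarrow> 'a set \<Rightarrow> bool" where
  "nonneg_subspace P L \<longleftrightarrow> csubspace L \<and> (\<forall>x\<in>L. 0 \<le> Re (cinner (Jop P x) x))"

definition max_nonneg_subspace :: "('a::chilbert \<Rightarrow> 'a) \<Rightarrow> 'a set \<Rightarrow> bool" where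
  "max_nonneg_subspace P L \<longleftrightarrow> nonneg_subspace P L
     \<and> (\<forall>L'. nonneg_subspace P L' \<and> L \<subseteq> L' \<longrightarrow> L' = L)"

definition op_invariant :: "'a::chilbert set \<Rightarrow> ('a \<Rightarrow> 'a) \<Rightarrow> 'a set \<Rightarrow> bool" where
  "op_invariant D T L \<longleftrightarrow> L \<subseteq> closure (D \<inter> L) \<and> (\<forall>x\<in>D \<inter> L. T x \<in> L)"

end

theory Submission
  imports Defs
begin

text \<open>
  Write \<open>Q = 1 - P\<close> and let \<open>S(\<mu>)\<close> be the Schur complement. Because \<open>A\<^sub>1\<^sub>2\<close> is compact relative to
  \<open>A\<^sub>2\<^sub>2\<close> and \<open>- A\<^sub>2\<^sub>2\<close> is m-dissipative, \<open>A\<^sub>1\<^sub>2 (A\<^sub>2\<^sub>2 + t)\<inverse>\<close> has arbitrarily small norm \<open>d\<close> for large \<open>t\<close>.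
  Both (a) and (b) give a lower bound \<open>(k \<bar>l\<bar> - M) \<parallel>p\<parallel> \<le> \<parallel>(S(-t) - l) p\<parallel>\<close> in which \<open>k\<close> does not
  depend on \<open>t\<close> (in (a), \<open>S(\<mu>)\<close> and \<open>S(-t)\<close> differ by a bounded operator). With \<open>y = A x\<close> this reads
  \<open>(k \<bar>l\<bar> - M) \<parallel>P x\<parallel> \<le> \<parallel>P (y - l x)\<parallel> + d \<parallel>Q (y + t x)\<parallel>\<close>, which survives the closure of \<open>A\<close>.
  On a nonnegative subspace \<open>\<parallel>Q x\<parallel> \<le> \<parallel>P x\<parallel>\<close>, so for \<open>d < k\<close> the last term is absorbed once \<open>\<bar>l\<bar>\<close> is
  large; the remaining \<open>l\<close> form a relatively compact subset of the resolvent set.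
\<close>

section \<open>Complex Hilbert spaces\<close>

lemma scaleC_zero_right [simp]: "scaleC c (0::'a::complex_vec) = 0"
  using scaleC_add_right[of c 0 "0::'a"] by simp

lemma scaleC_minus_right: "scaleC c (- x) = - scaleC c (x::'a::complex_vec)"
  using scaleC_add_right[of c x "- x"] by (simp add: eq_neg_iff_add_eq_0 add.commute)

lemma scaleC_diff_right: "scaleC c (x - y) = scaleC c x - scaleC c (y::'a::complex_vec)"
  using scaleC_add_right[of c x "- y"] by (simp add: scaleC_minus_right)

lemma scaleC_zero_left [simp]: "scaleC 0 x = (0::'a::complex_vec)"
  using scaleC_add_left[of 0 0 x] by simp

lemma scaleC_minus_left: "scaleC (- c) x = - scaleC c (x::'a::complex_vec)"
  using scaleC_add_left[of c "- c" x] by (simp add: eq_neg_iff_add_eq_0 add.commute)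

lemma scaleC_diff_left: "scaleC (a - b) x = scaleC a x - scaleC b (x::'a::complex_vec)"
  using scaleC_add_left[of a "- b" x] by (simp add: scaleC_minus_left)

lemma cinner_add_right: "cinner x (y + z) = cinner x y + cinner x (z::'a::chilbert)"
  by (metis cinner_add_left cinner_commute complex_cnj_add)

lemma cinner_scaleC_right: "cinner x (scaleC c y) = cnj c * cinner x (y::'a::chilbert)"
  by (metis cinner_scaleC_left cinner_commute complex_cnj_mult)

lemma cinner_minus_left: "cinner (- x) y = - cinner x (y::'a::chilbert)"
  using cinner_scaleC_left[of "- 1" x y] by (simp add: scaleC_minus_left scaleC_one)

lemma cinner_minus_right: "cinner x (- y) = - cinner x (y::'a::chilbert)"
  by (metis cinner_minus_left cinner_commute complex_cnj_minus)

lemma cinner_diff_left: "cinner (x - y) z = cinner x z - cinner y (z::'a::chilbert)"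
  using cinner_add_left[of x "- y" z] by (simp add: cinner_minus_left)

lemma cinner_diff_right: "cinner x (y - z) = cinner x y - cinner x (z::'a::chilbert)"
  using cinner_add_right[of x y "- z"] by (simp add: cinner_minus_right)

lemmas cinner_simps = cinner_add_left cinner_add_right cinner_diff_left cinner_diff_right

lemma Re_cinner_commute: "Re (cinner y x) = Re (cinner x (y::'a::chilbert))"
  by (metis cinner_commute cnj.simps(1))

lemma Re_cinner_self: "Re (cinner x x) = (norm (x::'a::chilbert))\<^sup>2"
  by (metis norm_eq_sqrt_cinner norm_ge_zero real_sqrt_ge_0_iff real_sqrt_pow2)

lemma norm_add_square: "(norm (x + y))\<^sup>2 = (norm x)\<^sup>2 + 2 * Re (cinner x y) + (norm (y::'a::chilbert))\<^sup>2"
  by (simp add: Re_cinner_self[symmetric] cinner_simps Re_cinner_commute[of y x])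

lemma parallelogram_law:
  "(norm (x - y))\<^sup>2 = 2 * (norm x)\<^sup>2 + 2 * (norm y)\<^sup>2 - (norm (x + (y::'a::chilbert)))\<^sup>2"
  by (simp add: Re_cinner_self[symmetric] cinner_simps)

lemma Re_cinner_polar: "Re (cinner x y) = ((norm (x + y))\<^sup>2 - (norm x)\<^sup>2 - (norm (y::'a::chilbert))\<^sup>2) / 2"
  by (simp add: norm_add_square)

text \<open>Polarization writes the real part of the inner product through norms, so continuity of
  the norm suffices.\<close>

lemma tendsto_Re_cinner:
  fixes f g :: "'b \<Rightarrow> 'a::chilbert"
  assumes "(f \<longlongrightarrow> a) F" "(g \<longlongrightarrow> b) F"
  shows "((\<lambda>x. Re (cinner (f x) (g x))) \<longlongrightarrow> Re (cinner a b)) F"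
  unfolding Re_cinner_polar by (intro tendsto_intros assms) auto

text \<open>The triangle inequality comes with the normed space class, so Cauchy-Schwarz is obtained
  from it by squaring, the reverse of the usual order.\<close>

lemma Re_cinner_le: "Re (cinner x y) \<le> norm x * norm (y::'a::chilbert)"
proof -
  have "(norm (x + y))\<^sup>2 \<le> (norm x + norm y)\<^sup>2"
    by (intro power_mono norm_triangle_ineq) auto
  then show ?thesis unfolding norm_add_square by (simp add: power2_sum)
qed

lemma norm_scaleC [simp]: "norm (scaleC c x) = cmod c * norm (x::'a::chilbert)"
proof -
  have "cinner (scaleC c x) (scaleC c x) = complex_of_real ((cmod c)\<^sup>2) * cinner x x"
    by (simp add: cinner_scaleC_left cinner_scaleC_right complex_norm_square mult.assoc
        del: of_real_power)
  then have "(norm (scaleC c x))\<^sup>2 = (cmod c)\<^sup>2 * (norm x)\<^sup>2"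
    by (simp add: Re_cinner_self[symmetric] del: of_real_power)
  then show ?thesis
    by (metis norm_ge_zero power2_eq_imp_eq power_mult_distrib mult_nonneg_nonneg)
qed

lemma bounded_linear_scaleC: "bounded_linear (scaleC c :: 'a::chilbert \<Rightarrow> 'a)"
proof (rule bounded_linear_intro[where K = "cmod c"])
  show "scaleC c (r *\<^sub>R x) = r *\<^sub>R scaleC c x" for r and x :: 'a
    by (simp add: scaleR_scaleC scaleC_scaleC mult.commute)
qed (auto simp: scaleC_add_right)

lemmas tendsto_scaleC = bounded_linear.tendsto[OF bounded_linear_scaleC]

section \<open>Complex subspaces and operators linear on a subspace\<close>

lemma csubspaceD:
  assumes "csubspace S"
  shows "0 \<in> S" "x \<in> S \<Longrightarrow> y \<in> S \<Longrightarrow> x + y \<in> S" "x \<in> S \<Longrightarrow> scaleC c x \<in> S"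
    "x \<in> S \<Longrightarrow> - x \<in> S" "x \<in> S \<Longrightarrow> y \<in> S \<Longrightarrow> x - y \<in> S" "x \<in> S \<Longrightarrow> r *\<^sub>R x \<in> S"
proof -
  show *: "0 \<in> S" "x \<in> S \<Longrightarrow> y \<in> S \<Longrightarrow> x + y \<in> S" "x \<in> S \<Longrightarrow> scaleC c x \<in> S" for x y c
    using assms by (auto simp: csubspace_def)
  show **: "x \<in> S \<Longrightarrow> - x \<in> S" for x
    using *(3)[of x "- 1"] by (simp add: scaleC_minus_left scaleC_one)
  show "x \<in> S \<Longrightarrow> y \<in> S \<Longrightarrow> x - y \<in> S"
    using *(2)[of x "- y"] **[of y] by simp
  show "x \<in> S \<Longrightarrow> r *\<^sub>R x \<in> S"
    by (simp add: scaleR_scaleC *)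
qed

lemma clinear_onD:
  assumes "clinear_on D T"
  shows "csubspace D" "x \<in> D \<Longrightarrow> y \<in> D \<Longrightarrow> T (x + y) = T x + T y"
    "x \<in> D \<Longrightarrow> T (scaleC c x) = scaleC c (T x)" "T 0 = 0" "x \<in> D \<Longrightarrow> T (- x) = - T x"
    "x \<in> D \<Longrightarrow> y \<in> D \<Longrightarrow> T (x - y) = T x - T y" "x \<in> D \<Longrightarrow> T (r *\<^sub>R x) = r *\<^sub>R T x"
proof -
  show S: "csubspace D" using assms by (auto simp: clinear_on_def)
  show *: "x \<in> D \<Longrightarrow> y \<in> D \<Longrightarrow> T (x + y) = T x + T y"
    "x \<in> D \<Longrightarrow> T (scaleC c x) = scaleC c (T x)" for x y c
    using assms by (auto simp: clinear_on_def)
  show "T 0 = 0" using *(2)[of 0 0] S by (simp add: csubspaceD)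
  show **: "x \<in> D \<Longrightarrow> T (- x) = - T x" for x
    using *(2)[of x "- 1"] by (simp add: scaleC_minus_left scaleC_one)
  show "x \<in> D \<Longrightarrow> y \<in> D \<Longrightarrow> T (x - y) = T x - T y"
    using *(1)[of x "- y"] **[of y] csubspaceD(4)[OF S, of y] by simp
  show "x \<in> D \<Longrightarrow> T (r *\<^sub>R x) = r *\<^sub>R T x"
    by (simp add: scaleR_scaleC *)
qed

lemma csubspace_closure:
  fixes S :: "'a::chilbert set"
  assumes "csubspace S"
  shows "csubspace (closure S)"
  unfolding csubspace_def
proof (intro conjI ballI allI)
  show "0 \<in> closure S"
    using csubspaceD(1)[OF assms] closure_subset by blast
  fix x assume "x \<in> closure S"
  then obtain u where u: "\<And>n. u n \<in> S" "u \<longlonglongrightarrow> x"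
    unfolding closure_sequential by blast
  show "scaleC c x \<in> closure S" for c
    unfolding closure_sequential using u
    by (intro exI[of _ "\<lambda>n. scaleC c (u n)"]) (auto intro: tendsto_scaleC csubspaceD[OF assms])
  fix y assume "y \<in> closure S"
  then obtain v where v: "\<And>n. v n \<in> S" "v \<longlonglongrightarrow> y"
    unfolding closure_sequential by blast
  show "x + y \<in> closure S"
    unfolding closure_sequential using u v
    by (intro exI[of _ "\<lambda>n. u n + v n"]) (auto intro: tendsto_add csubspaceD[OF assms])
qed

text \<open>A replacement for weak compactness: near-minimal elements of the tails form a Cauchy
  sequence by the parallelogram law.\<close>

lemma Cauchy_selection_midpoint_convex:
  fixes U :: "nat \<Rightarrow> 'a::chilbert set"
  assumes anti: "\<And>m n. m \<le> n \<Longrightarrow> U n \<subseteq> U m" and ne: "\<And>n. U n \<noteq> {}"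
    and mid: "\<And>n x y. x \<in> U n \<Longrightarrow> y \<in> U n \<Longrightarrow> (1/2) *\<^sub>R (x + y) \<in> U n"
    and bd: "\<And>x. x \<in> U 0 \<Longrightarrow> norm x \<le> B"
  shows "\<exists>u. (\<forall>n. u n \<in> U n) \<and> Cauchy u"
proof -
  \<comment> \<open>The distance of \<open>U n\<close> from the origin increases with
    \<open>n\<close> and is at most \<open>B\<close>, hence converges.\<close>
  define d where "d n = Inf (norm ` U n)" for n
  have bdd: "bdd_below (norm ` U n)" for n
    by (intro bdd_belowI[of _ 0]) auto
  have d_le: "d n \<le> norm x" if "x \<in> U n" for n x
    unfolding d_def using bdd that by (intro cInf_lower) auto
  have d0: "0 \<le> d n" for n
    unfolding d_def using ne by (intro cInf_greatest) auto
  have "incseq d"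
    unfolding d_def incseq_def using anti ne bdd by (intro allI impI cInf_superset_mono image_mono) auto
  moreover have "d n \<le> B" for n
    using ne[of n] d_le anti[of 0 n] bd by fastforce
  ultimately obtain l where l: "d \<longlonglongrightarrow> l"
    using incseq_convergent by blast
  have "\<exists>x\<in>U n. norm x < d n + 1 / real (Suc n)" for n
    using cInf_lessD[of "norm ` U n" "d n + 1 / real (Suc n)"] ne by (auto simp: d_def)
  then obtain u where u: "\<And>n. u n \<in> U n" "\<And>n. norm (u n) < d n + 1 / real (Suc n)"
    by metis
  have lim: "(\<lambda>n. d n + 1 / real (Suc n)) \<longlonglongrightarrow> l + 0"
    by (intro tendsto_add l LIMSEQ_Suc[OF lim_1_over_n])
  have nu: "(\<lambda>n. norm (u n)) \<longlonglongrightarrow> l"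
  proof (rule tendsto_sandwich[OF _ _ l])
    show "\<forall>\<^sub>F n in sequentially. d n \<le> norm (u n)"
      by (intro always_eventually allI d_le u)
    show "\<forall>\<^sub>F n in sequentially. norm (u n) \<le> d n + 1 / real (Suc n)"
      by (intro always_eventually allI less_imp_le u)
  qed (use lim in simp)
  have "Cauchy u"
  proof (rule metric_CauchyI)
    fix e :: real assume e: "0 < e"
    \<comment> \<open>In the parallelogram law, 2 (l^2 + f) + 2 (l^2 + f) - 4 (l^2 - f) = 8 f, which
      is to equal e^2.\<close>
    define f where "f = e\<^sup>2 / 8"
    have f: "0 < f" using e by (simp add: f_def)
    have "\<forall>\<^sub>F n in sequentially. (norm (u n))\<^sup>2 < l\<^sup>2 + f"
      using f by (intro order_tendstoD(2)[OF tendsto_power[OF nu, of 2]]) simp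
    moreover have "\<forall>\<^sub>F n in sequentially. l\<^sup>2 - f < (d n)\<^sup>2"
      using f by (intro order_tendstoD(1)[OF tendsto_power[OF l, of 2]]) simp
    ultimately have "\<forall>\<^sub>F n in sequentially. (norm (u n))\<^sup>2 < l\<^sup>2 + f \<and> l\<^sup>2 - f < (d n)\<^sup>2"
      by (rule eventually_conj)
    then obtain N where N: "\<And>n. n \<ge> N \<Longrightarrow> (norm (u n))\<^sup>2 < l\<^sup>2 + f"
      "\<And>n. n \<ge> N \<Longrightarrow> l\<^sup>2 - f < (d n)\<^sup>2"
      unfolding eventually_sequentially by blast
    show "\<exists>M. \<forall>m\<ge>M. \<forall>n\<ge>M. dist (u m) (u n) < e"
    proof (intro exI allI impI)
      fix m n assume mn: "m \<ge> N" "n \<ge> N"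
      then have "(1/2) *\<^sub>R (u m + u n) \<in> U N"
        using u anti by (intro mid) blast+
      then have "2 * d N \<le> norm (u m + u n)"
        using d_le[of "(1/2) *\<^sub>R (u m + u n)" N] by simp
      then have "(2 * d N)\<^sup>2 \<le> (norm (u m + u n))\<^sup>2"
        using d0 by (intro power_mono) auto
      then have "(norm (u m - u n))\<^sup>2 < 8 * f"
        unfolding parallelogram_law using N(1)[OF mn(1)] N(1)[OF mn(2)] N(2)[OF order_refl]
        by (simp add: power_mult_distrib)
      also have "\<dots> = e\<^sup>2" by (simp add: f_def)
      finally show "dist (u m) (u n) < e"
        using e unfolding dist_norm by (simp add: power2_less_imp_less)
    qed
  qed
  then show ?thesis using u by blast
qed

section \<open>Resolvents and dissipative operators\<close>

text \<open>Hypothesis (i) concerns - A22, whereas F and G use resolvents of A22 itself in the left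
  half-plane.\<close>

lemma in_resolvent_uminus:
  assumes "in_resolvent X D (\<lambda>x. - T x) l" "csubspace X"
  shows "in_resolvent X D T (- l)"
proof -
  have eq: "T x - scaleC (- l) x = - (- T x - scaleC l x)" for x
    by (simp add: scaleC_minus_left)
  have "bij_betw uminus X X"
    by (intro bij_betw_byWitness[where f' = uminus]) (auto intro: csubspaceD[OF assms(2)])
  then have "bij_betw (uminus \<circ> (\<lambda>x. - T x - scaleC l x)) D X"
    using assms(1) by (auto simp: in_resolvent_def intro: bij_betw_trans)
  moreover have "\<exists>C. \<forall>x\<in>D. norm x \<le> C * norm (T x - scaleC (- l) x)"
    using assms(1) unfolding eq norm_minus_cancel by (simp add: in_resolvent_def)
  ultimately show ?thesis
    unfolding in_resolvent_def o_def eq by simp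
qed

lemma res_in_resolvent:
  assumes "in_resolvent X D T l" "y \<in> X"
  shows "res D T l y \<in> D" "T (res D T l y) - scaleC l (res D T l y) = y"
  using assms the_inv_into_into[of "\<lambda>x. T x - scaleC l x" D y D]
    f_the_inv_into_f[of "\<lambda>x. T x - scaleC l x" D y]
  by (auto simp: in_resolvent_def bij_betw_def res_def)

lemma res_eqI:
  assumes "in_resolvent X D T l" "x \<in> D" "T x - scaleC l x = y"
  shows "res D T l y = x"
  using assms the_inv_into_f_f[of "\<lambda>x. T x - scaleC l x" D x]
  by (auto simp: in_resolvent_def bij_betw_def res_def)

lemma clinear_on_res_comp:
  assumes "in_resolvent X D T l" "clinear_on D T" "clinear_on E Z" "Z ` E \<subseteq> X"
  shows "clinear_on E (\<lambda>x. res D T l (Z x))"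
  unfolding clinear_on_def
proof (intro conjI ballI allI)
  note T = clinear_onD[OF assms(2)] and Z = clinear_onD[OF assms(3)]
  note r = res_in_resolvent[OF assms(1)]
  have zx: "Z x \<in> X" if "x \<in> E" for x using assms(4) that by auto
  show "csubspace E" by (rule Z)
  fix x assume x: "x \<in> E"
  show "res D T l (Z (scaleC c x)) = scaleC c (res D T l (Z x))" for c
  proof (rule res_eqI[OF assms(1)])
    let ?u = "res D T l (Z x)"
    show "scaleC c ?u \<in> D" using r(1) zx x by (auto intro: csubspaceD[OF T(1)])
    have "T (scaleC c ?u) - scaleC l (scaleC c ?u) = scaleC c (T ?u - scaleC l ?u)"
      using r(1) zx x by (simp add: T scaleC_diff_right scaleC_scaleC mult.commute)
    then show "T (scaleC c ?u) - scaleC l (scaleC c ?u) = Z (scaleC c x)"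
      using r(2) zx x by (simp add: Z)
  qed
  fix y assume y: "y \<in> E"
  show "res D T l (Z (x + y)) = res D T l (Z x) + res D T l (Z y)"
  proof (rule res_eqI[OF assms(1)])
    let ?u = "res D T l (Z x)" and ?v = "res D T l (Z y)"
    show "?u + ?v \<in> D" using r(1) zx x y by (auto intro: csubspaceD[OF T(1)])
    have "T (?u + ?v) - scaleC l (?u + ?v) = (T ?u - scaleC l ?u) + (T ?v - scaleC l ?v)"
      using r(1) zx x y by (simp add: T scaleC_add_right)
    then show "T (?u + ?v) - scaleC l (?u + ?v) = Z (x + y)"
      using r(2) zx x y by (simp add: Z)
  qed
qed

text \<open>Along a convergent sequence of the graph, the values of T - l converge inside the closed
  set \<open>X\<close>, so their limit is attained at some \<open>x\<close> of the domain; the lower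
  bound for T - l then identifies \<open>x\<close> with the limit of the arguments.\<close>

lemma closed_op_in_resolvent:
  assumes "in_resolvent X D T l" "clinear_on D T" "closed X"
  shows "closed_op D T"
  unfolding closed_op_def closed_sequential_limits
proof (intro allI impI, elim conjE)
  fix z p assume z: "\<forall>n. z n \<in> op_graph D T" and lim: "z \<longlonglongrightarrow> p"
  define u where "u n = fst (z n)" for n
  have zu: "z n = (u n, T (u n))" and uD: "u n \<in> D" for n
    using z[rule_format, of n] by (auto simp: op_graph_def u_def)
  have u: "u \<longlonglongrightarrow> fst p" and Tu: "(\<lambda>n. T (u n)) \<longlonglongrightarrow> snd p"
    using tendsto_fst[OF lim] tendsto_snd[OF lim] by (simp_all add: zu)
  have v: "(\<lambda>n. T (u n) - scaleC l (u n)) \<longlonglongrightarrow> snd p - scaleC l (fst p)"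
    by (intro tendsto_diff Tu tendsto_scaleC u)
  have "T (u n) - scaleC l (u n) \<in> X" for n
    using assms(1) uD by (auto simp: in_resolvent_def bij_betw_def)
  then have "snd p - scaleC l (fst p) \<in> X"
    by (rule closed_sequentially[OF assms(3) _ v])
  then obtain x where x: "x \<in> D" "T x - scaleC l x = snd p - scaleC l (fst p)"
    using res_in_resolvent[OF assms(1)] by blast
  obtain C where C: "\<And>x. x \<in> D \<Longrightarrow> norm x \<le> C * norm (T x - scaleC l x)"
    using assms(1) by (auto simp: in_resolvent_def)
  note T = clinear_onD[OF assms(2)]
  have "u \<longlonglongrightarrow> x"
  proof (rule LIM_zero_cancel, rule Lim_null_comparison)
    have "norm (u n - x) \<le> C * norm ((T (u n) - scaleC l (u n)) - (T x - scaleC l x))" for n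
      using C[of "u n - x"] uD x by (simp add: T csubspaceD[OF T(1)] scaleC_diff_right algebra_simps)
    then show "\<forall>\<^sub>F n in sequentially. norm (u n - x)
        \<le> C * norm ((T (u n) - scaleC l (u n)) - (T x - scaleC l x))" by simp
    show "(\<lambda>n. C * norm ((T (u n) - scaleC l (u n)) - (T x - scaleC l x))) \<longlonglongrightarrow> 0"
      using LIM_zero[OF v] unfolding x(2)
      by (intro tendsto_mult_right_zero tendsto_norm_zero)
  qed
  then have "fst p = x" using u LIMSEQ_unique by blast
  then have "p = (x, T x)" using x by (cases p) auto
  then show "p \<in> op_graph D T" using x by (auto simp: op_graph_def)
qed

text \<open>A lower bound at one point survives on a small disc around it with twice the constant,
  and finitely many discs cover \<open>K\<close>. Summing the constants of these discs replaces a
  maximum.\<close>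

lemma resolvent_bound_compact:
  fixes K :: "complex set"
  assumes "compact K" "\<And>l. l \<in> K \<Longrightarrow> in_resolvent X D T l"
  shows "\<exists>C. \<forall>l\<in>K. \<forall>x\<in>D. norm x \<le> C * norm (T x - scaleC l x)"
proof -
  have "\<exists>C>0. \<forall>x\<in>D. norm x \<le> C * norm (T x - scaleC l x)" if l: "l \<in> K" for l
  proof -
    obtain C where "\<forall>x\<in>D. norm x \<le> C * norm (T x - scaleC l x)"
      using assms(2)[OF l] by (auto simp: in_resolvent_def)
    then show ?thesis
      by (intro exI[of _ "max C 1"]) (fastforce intro: order_trans mult_right_mono)
  qed
  then obtain c where c: "\<And>l. l \<in> K \<Longrightarrow> 0 < c l"
    "\<And>l x. l \<in> K \<Longrightarrow> x \<in> D \<Longrightarrow> norm x \<le> c l * norm (T x - scaleC l x)" by metis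
  \<comment> \<open>With this radius, passing from \<open>l\<close> to the centre \<open>m\<close>
    costs at most \<open>norm x / (2 * c m)\<close>; multiplied by \<open>c m\<close> this is half
    of \<open>norm x\<close>, which can be absorbed.\<close>
  have "K \<subseteq> (\<Union>l\<in>K. ball l (1 / (2 * c l)))" using c by force
  then obtain N where N: "N \<subseteq> K" "finite N" "K \<subseteq> (\<Union>l\<in>N. ball l (1 / (2 * c l)))"
    using compactE_image[OF assms(1), of K "\<lambda>l. ball l (1 / (2 * c l))"] by blast
  show ?thesis
  proof (intro exI ballI)
    fix l x assume "l \<in> K" and x: "x \<in> D"
    then obtain m where m: "m \<in> N" "cmod (m - l) < 1 / (2 * c m)"
      using N(3) by (auto simp: dist_norm)
    have cm: "0 < c m" using m N c by auto
    let ?y = "norm (T x - scaleC l x)"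
    have "norm (T x - scaleC m x) \<le> ?y + norm (scaleC (m - l) x)"
      using norm_triangle_ineq4[of "T x - scaleC l x" "scaleC (m - l) x"] by (simp add: scaleC_diff_left)
    also have "\<dots> \<le> ?y + 1 / (2 * c m) * norm x"
      unfolding norm_scaleC using m(2) by (intro add_left_mono mult_right_mono) auto
    finally have "c m * norm (T x - scaleC m x) \<le> c m * (?y + 1 / (2 * c m) * norm x)"
      using cm by simp
    then have "norm x \<le> c m * ?y + norm x / 2"
      using c(2)[of m x] x m N(1) cm by (auto simp: algebra_simps)
    then have "norm x \<le> 2 * c m * ?y" by simp
    also have "\<dots> \<le> (\<Sum>m\<in>N. 2 * c m) * ?y"
      using m N c by (intro mult_right_mono member_le_sum) (auto intro: less_imp_le)
    finally show "norm x \<le> (\<Sum>m\<in>N. 2 * c m) * ?y" .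
  qed
qed

text \<open>A densely defined dissipative operator is closable. Let h be y - T x. Approximants
  \<open>u n\<close> have \<open>u n - x\<close> tending to 0 and \<open>T (u n - x)\<close> tending
  to h. Testing dissipativity on \<open>u n - x + r *\<^sub>R w\<close>, dividing the limit by
  \<open>r\<close> and letting \<open>r\<close> tend to 0 gives Re (h, w) \<le> 0 on
  \<open>D\<close>; density then allows w to tend to h.\<close>

lemma dissipative_closable:
  fixes T :: "'a::chilbert \<Rightarrow> 'a"
  assumes lin: "clinear_on D T" and diss: "dissipative_op D T" and cl: "closed X" "csubspace X"
    and dense: "X \<subseteq> closure D" and T: "T ` D \<subseteq> X"
    and x: "x \<in> D" and xy: "(x, y) \<in> closure (op_graph D T)"
  shows "y = T x"
proof -
  note L = clinear_onD[OF lin]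
  obtain z where z: "\<And>n. z n \<in> op_graph D T" and lim: "z \<longlonglongrightarrow> (x, y)"
    using xy unfolding closure_sequential by blast
  define u where "u n = fst (z n)" for n
  have zu: "z n = (u n, T (u n))" and uD: "u n \<in> D" for n
    using z[of n] by (auto simp: op_graph_def u_def)
  have u: "u \<longlonglongrightarrow> x" and Tu: "(\<lambda>n. T (u n)) \<longlonglongrightarrow> y"
    using tendsto_fst[OF lim] tendsto_snd[OF lim] by (simp_all add: zu)
  have yX: "y \<in> X"
    by (rule closed_sequentially[OF cl(1) _ Tu]) (use T uD in blast)
  have u0: "(\<lambda>n. u n - x) \<longlonglongrightarrow> 0" and Tu0: "(\<lambda>n. T (u n - x)) \<longlonglongrightarrow> y - T x"
    using LIM_zero[OF u] tendsto_diff[OF Tu tendsto_const, of "T x"] uD x by (simp_all add: L)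
  have *: "Re (cinner (y - T x) w) \<le> 0" if w: "w \<in> D" for w
  proof -
    have s: "Re (cinner (y - T x + r *\<^sub>R T w) w) \<le> 0" if r: "0 < r" for r :: real
    proof -
      have "Re (cinner (T (u n - x) + r *\<^sub>R T w) ((u n - x) + r *\<^sub>R w)) \<le> 0" for n
        using diss uD x w unfolding dissipative_op_def
        by (metis L(2,7) csubspaceD(2,5,6)[OF L(1)])
      moreover have "(\<lambda>n. Re (cinner (T (u n - x) + r *\<^sub>R T w) ((u n - x) + r *\<^sub>R w)))
          \<longlonglongrightarrow> Re (cinner (y - T x + r *\<^sub>R T w) (0 + r *\<^sub>R w))"
        by (intro tendsto_Re_cinner tendsto_add u0 Tu0 tendsto_const)
      ultimately have "Re (cinner (y - T x + r *\<^sub>R T w) (0 + r *\<^sub>R w)) \<le> 0"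
        by (intro LIMSEQ_le_const2[of _ _ 0]) auto
      then show ?thesis
        using r by (simp add: scaleR_scaleC cinner_scaleC_right mult_le_0_iff)
    qed
    have "(\<lambda>n. Re (cinner (y - T x + (1 / real (Suc n)) *\<^sub>R T w) w))
        \<longlonglongrightarrow> Re (cinner (y - T x + 0 *\<^sub>R T w) w)"
      by (intro tendsto_Re_cinner tendsto_intros LIMSEQ_Suc[OF lim_1_over_n])
    then show ?thesis
      using s by (intro LIMSEQ_le_const2[of _ _ 0]) auto
  qed
  have "y - T x \<in> X" using yX T x by (auto intro: csubspaceD[OF cl(2)])
  then have "y - T x \<in> closure D" using dense by blast
  then obtain w where w: "\<And>n. w n \<in> D" "w \<longlonglongrightarrow> y - T x"
    unfolding closure_sequential by blast
  have "(\<lambda>n. Re (cinner (y - T x) (w n))) \<longlonglongrightarrow> Re (cinner (y - T x) (y - T x))"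
    by (intro tendsto_Re_cinner tendsto_const w)
  then have "Re (cinner (y - T x) (y - T x)) \<le> 0"
    using * w by (intro LIMSEQ_le_const2[of _ _ 0]) auto
  then show ?thesis unfolding Re_cinner_self by simp
qed

section \<open>Operators compact relative to an m-dissipative one\<close>

text \<open>A compact operator is bounded on the unit ball of \<open>X\<close>; scaling
  \<open>q\<close> so that its image under T - l is a unit vector turns this into a relative bound
  on the domain.\<close>

lemma compact_resolvent_bound:
  assumes R: "in_resolvent X D T l" and T: "clinear_on D T" and K: "clinear_on D K"
    and comp: "compact_op X (\<lambda>y. K (res D T l y))"
  shows "\<exists>M\<ge>0. \<forall>q\<in>D. norm (K q) \<le> M * norm (T q - scaleC l q)"
proof -
  note T' = clinear_onD[OF T] and K' = clinear_onD[OF K]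
  let ?G = "\<lambda>y. K (res D T l y)"
  have "compact (closure (?G ` (X \<inter> cball 0 1)))"
    using comp unfolding compact_op_def by (elim allE[of _ "X \<inter> cball 0 1"] impE) (auto simp: bounded_Int)
  then have "bounded (closure (?G ` (X \<inter> cball 0 1)))" by (rule compact_imp_bounded)
  then obtain M where M: "0 < M" "\<And>z. z \<in> closure (?G ` (X \<inter> cball 0 1)) \<Longrightarrow> norm z \<le> M"
    unfolding bounded_pos by blast
  have "norm (K q) \<le> M * norm (T q - scaleC l q)" if q: "q \<in> D" for q
  proof (cases "T q - scaleC l q = 0")
    \<comment> \<open>A zero image cannot be normalised, but the resolvent bound forces
      \<open>q = 0\<close> there.\<close>
    case True
    moreover have "\<exists>C. \<forall>x\<in>D. norm x \<le> C * norm (T x - scaleC l x)"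
      using R by (simp add: in_resolvent_def)
    ultimately have "q = 0" using q by fastforce
    then show ?thesis using M(1) by (simp add: K')
  next
    case False
    define r where "r = 1 / norm (T q - scaleC l q)"
    have rq: "r *\<^sub>R q \<in> D" using csubspaceD(6)[OF T'(1) q] .
    let ?y = "T (r *\<^sub>R q) - scaleC l (r *\<^sub>R q)"
    have y: "?y = r *\<^sub>R (T q - scaleC l q)"
      using q by (simp add: T' scaleR_scaleC scaleC_diff_right scaleC_scaleC mult.commute)
    have "norm ?y \<le> 1" unfolding y using False by (simp add: r_def)
    moreover have "?y \<in> X" using R rq by (auto simp: in_resolvent_def bij_betw_def)
    moreover have "?G ?y = r *\<^sub>R K q"
      using res_eqI[OF R rq refl] q by (simp add: K')
    ultimately have "r *\<^sub>R K q \<in> ?G ` (X \<inter> cball 0 1)"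
      by (intro image_eqI[of _ _ ?y]) auto
    then have "r *\<^sub>R K q \<in> closure (?G ` (X \<inter> cball 0 1))"
      by (rule subsetD[OF closure_subset])
    then have "norm (r *\<^sub>R K q) \<le> M" by (rule M(2))
    then show ?thesis using False by (simp add: r_def divide_le_eq)
  qed
  then show ?thesis using M(1) by (intro exI[of _ M] conjI ballI) auto
qed

lemma scaleC_minus_of_real: "scaleC (- complex_of_real t) x = - (t *\<^sub>R x)"
  by (simp add: scaleC_minus_left scaleR_scaleC)

text \<open>Pair \<open>T q + t *\<^sub>R q\<close> with \<open>q\<close>: dissipativity of - T
  makes the T-part nonnegative, and Cauchy-Schwarz bounds the pairing from above.\<close>

lemma dissipative_lower_bound:
  assumes "dissipative_op D (\<lambda>x. - T x)" "q \<in> D"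
  shows "t * norm q \<le> norm (T q + t *\<^sub>R q)"
proof (cases "q = 0")
  case False
  have "t * (norm q)\<^sup>2 \<le> Re (cinner (T q + t *\<^sub>R q) q)"
    using assms unfolding dissipative_op_def
    by (auto simp: cinner_add_left cinner_minus_left scaleR_scaleC cinner_scaleC_left Re_cinner_self)
  also have "\<dots> \<le> norm (T q + t *\<^sub>R q) * norm q" by (rule Re_cinner_le)
  finally show ?thesis using False by (simp add: power2_eq_square)
qed simp

text \<open>If the bound fails for every \<open>t\<close>, normalised violators \<open>q n\<close>
  tend to 0 while (T + 1) \<open>q n\<close> stays bounded and \<open>K (q n)\<close> clusters at a
  unit vector \<open>g\<close>. The classical argument takes a weak limit of (T + 1)
  \<open>q n\<close>; here a midpoint-convex selection yields a norm convergent substitute, along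
  which \<open>K\<close> tends both to \<open>g\<close> and to 0.\<close>

lemma compact_resolvent_decay:
  fixes T K :: "'a::chilbert \<Rightarrow> 'a"
  assumes mT: "m_dissipative X D (\<lambda>x. - T x)" and X: "csubspace X" "closed X"
    and T: "clinear_on D T" and K: "clinear_on D K"
    and comp: "compact_op X (\<lambda>y. K (res D T (- 1) y))" and d: "0 < d"
  shows "\<exists>t>0. \<forall>q\<in>D. norm (K q) \<le> d * norm (T q + t *\<^sub>R q)"
proof (rule ccontr)
  assume "\<not> ?thesis"
  then have contr: "\<exists>q\<in>D. d * norm (T q + t *\<^sub>R q) < norm (K q)" if "0 < t" for t
    using that by (simp add: not_le)
  note T' = clinear_onD[OF T] and K' = clinear_onD[OF K] and S' = csubspaceD[OF clinear_onD(1)[OF T]]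
  have R: "in_resolvent X D T (- 1)"
    using mT X by (intro in_resolvent_uminus) (auto simp: m_dissipative_def)
  have diss: "dissipative_op D (\<lambda>x. - T x)" using mT by (simp add: m_dissipative_def)
  define W where "W q = T q + q" for q
  have W: "T q - scaleC (- 1) q = W q" for q
    by (simp add: W_def scaleC_minus_left scaleC_one)
  have W_lin: "W ((1/2) *\<^sub>R (x + y)) = (1/2) *\<^sub>R (W x + W y)" if "x \<in> D" "y \<in> D" for x y
    using that by (simp add: W_def T' S' scaleR_add_right)
  have W_bij: "bij_betw W D X" using R unfolding in_resolvent_def W by blast
  obtain C where C: "\<And>x. x \<in> D \<Longrightarrow> norm x \<le> C * norm (W x)"
    using R unfolding in_resolvent_def W by blast
  obtain M where M: "\<And>q. q \<in> D \<Longrightarrow> norm (K q) \<le> M * norm (W q)"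
    using compact_resolvent_bound[OF R T K comp] unfolding W by blast
  \<comment> \<open>A violator for t = n + 1 is scaled to \<open>norm (K q) = 1\<close>;
    \<open>Suc\<close> keeps t positive at n = 0.\<close>
  have "\<exists>q\<in>D. norm (K q) = 1 \<and> norm (T q + real (Suc n) *\<^sub>R q) < 1 / d" for n
  proof -
    obtain q where q: "q \<in> D" "d * norm (T q + real (Suc n) *\<^sub>R q) < norm (K q)"
      using contr[of "real (Suc n)"] by auto
    have Kq: "0 < norm (K q)"
      using q(2) d by (intro le_less_trans[OF _ q(2)]) simp
    define r where "r = 1 / norm (K q)"
    have r: "0 < r" using Kq by (simp add: r_def)
    have "T (r *\<^sub>R q) + real (Suc n) *\<^sub>R (r *\<^sub>R q) = r *\<^sub>R (T q + real (Suc n) *\<^sub>R q)"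
      using q(1) by (simp add: T' scaleR_add_right mult.commute)
    then have "norm (T (r *\<^sub>R q) + real (Suc n) *\<^sub>R (r *\<^sub>R q)) = r * norm (T q + real (Suc n) *\<^sub>R q)"
      using r by simp
    also have "\<dots> < 1 / d" using q(2) d Kq by (simp add: r_def field_simps)
    finally show ?thesis
      using q(1) Kq r by (intro bexI[of _ "r *\<^sub>R q"]) (auto simp: K' S' r_def)
  qed
  then obtain q where q: "\<And>n. q n \<in> D" "\<And>n. norm (K (q n)) = 1"
    "\<And>n. norm (T (q n) + real (Suc n) *\<^sub>R q n) < 1 / d" by metis
  have qn: "real (Suc n) * norm (q n) \<le> 1 / d" for n
    using dissipative_lower_bound[OF diss q(1)[of n], of "real (Suc n)"] q(3)[of n] by simp
  \<comment> \<open>\<open>W\<close> is T + 1, so it differs from T + (n + 1) by exactly n; each of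
    the two terms is at most \<open>1 / d\<close>.\<close>
  have Wq: "norm (W (q n)) \<le> 2 / d" for n
  proof -
    have "W (q n) = (T (q n) + real (Suc n) *\<^sub>R q n) - real n *\<^sub>R q n"
      by (simp add: W_def algebra_simps)
    then have "norm (W (q n)) \<le> norm (T (q n) + real (Suc n) *\<^sub>R q n) + norm (real n *\<^sub>R q n)"
      by (metis norm_triangle_ineq4)
    also have "\<dots> \<le> 1 / d + 1 / d"
    proof (intro add_mono)
      have "norm (real n *\<^sub>R q n) \<le> real (Suc n) * norm (q n)"
        by (simp add: mult_right_mono)
      then show "norm (real n *\<^sub>R q n) \<le> 1 / d" using qn[of n] by linarith
    qed (use q(3)[of n] in simp)
    finally show ?thesis by simp
  qed
  let ?G = "\<lambda>y. K (res D T (- 1) y)"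
  have "W (q n) \<in> X" for n using W_bij q(1) by (auto simp: bij_betw_def)
  then have "range (\<lambda>n. W (q n)) \<subseteq> X \<and> bounded (range (\<lambda>n. W (q n)))"
    using Wq by (auto simp: bounded_iff)
  then have "compact (closure (?G ` range (\<lambda>n. W (q n))))"
    using comp unfolding compact_op_def by blast
  moreover have "?G (W (q n)) = K (q n)" for n
    using res_eqI[OF R q(1)[of n] W] by simp
  then have "K (q n) \<in> closure (?G ` range (\<lambda>n. W (q n)))" for n
    by (metis closure_subset imageI rangeI subsetD)
  ultimately obtain g r where g: "strict_mono r" "((\<lambda>n. K (q n)) \<circ> r) \<longlonglongrightarrow> g"
    unfolding compact_def by meson
  have "(\<lambda>n. norm (((\<lambda>n. K (q n)) \<circ> r) n)) \<longlonglongrightarrow> norm g" by (rule tendsto_norm[OF g(2)])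
  then have ng: "norm g = 1" using q(2) by (simp add: LIMSEQ_const_iff)
  define V where "V n = {x \<in> D. norm x \<le> 1 / real (Suc n) \<and> norm (W x) \<le> 2 / d
      \<and> dist (K x) g \<le> 1 / real (Suc n)}" for n
  have q0: "(\<lambda>n. q (r n)) \<longlonglongrightarrow> 0"
  proof -
    have "norm (q n) \<le> 1 / d * (1 / real (Suc n))" for n
      using qn[of n] unfolding times_divide_eq_right mult_1_right
      by (subst pos_le_divide_eq) (simp_all only: mult.commute of_nat_0_less_iff zero_less_Suc)
    then have "q \<longlonglongrightarrow> 0"
      by (rule Lim_null_comparison[OF always_eventually[OF allI]
            tendsto_mult_right_zero[OF LIMSEQ_Suc[OF lim_1_over_n]]])
    then show ?thesis using LIMSEQ_subseq_LIMSEQ[OF _ g(1)] by (simp add: o_def)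
  qed
  have V_ne: "V n \<noteq> {}" for n
  proof -
    have e: "0 < 1 / real (Suc n)" by simp
    have "\<forall>\<^sub>F j in sequentially. dist (q (r j)) 0 < 1 / real (Suc n)"
      by (rule tendstoD[OF q0 e])
    moreover have "\<forall>\<^sub>F j in sequentially. dist (K (q (r j))) g < 1 / real (Suc n)"
      using tendstoD[OF g(2) e] by (simp add: o_def)
    ultimately have "\<forall>\<^sub>F j in sequentially. q (r j) \<in> V n"
      by eventually_elim (use q(1) Wq in \<open>auto simp: V_def\<close>)
    then show ?thesis using eventually_happens'[OF sequentially_bot] by blast
  qed
  have half: "norm ((1/2) *\<^sub>R (a + b)) \<le> e" if "norm a \<le> e" "norm b \<le> e" for a b :: 'a and e
    using norm_triangle_ineq[of a b] that by simp
  have V_mid: "(1/2) *\<^sub>R (x + y) \<in> V n" if xy: "x \<in> V n" "y \<in> V n" for n x y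
  proof -
    have D: "x \<in> D" "y \<in> D" using xy by (auto simp: V_def)
    have "K ((1/2) *\<^sub>R (x + y)) - g = (1/2) *\<^sub>R ((K x - g) + (K y - g))"
      using D by (simp add: K' S' algebra_simps flip: scaleR_add_left)
    then show ?thesis
      using xy D half W_lin[OF D] unfolding V_def dist_norm
      by (auto simp: S' simp del: norm_scaleR)
  qed
  have V_anti: "V n \<subseteq> V m" if "m \<le> n" for m n
  proof -
    have "1 / real (Suc n) \<le> 1 / real (Suc m)" using that by (simp add: field_simps)
    then show ?thesis unfolding V_def by force
  qed
  have "\<exists>u. (\<forall>n. u n \<in> W ` V n) \<and> Cauchy u"
  proof (rule Cauchy_selection_midpoint_convex)
    show "W ` V n \<subseteq> W ` V m" if "m \<le> n" for m n using V_anti[OF that] by blast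
    show "W ` V n \<noteq> {}" for n using V_ne by simp
    show "norm x \<le> 2 / d" if "x \<in> W ` V 0" for x using that by (auto simp: V_def)
    show "(1/2) *\<^sub>R (x + y) \<in> W ` V n" if xy: "x \<in> W ` V n" "y \<in> W ` V n" for n x y
    proof -
      obtain a b where ab: "a \<in> V n" "b \<in> V n" "x = W a" "y = W b" using xy by blast
      then have "(1/2) *\<^sub>R (x + y) = W ((1/2) *\<^sub>R (a + b))"
        using W_lin[of a b] by (simp add: V_def)
      then show ?thesis using V_mid[OF ab(1,2)] by blast
    qed
  qed
  then obtain u where u: "\<forall>n. u n \<in> W ` V n" "Cauchy u" by (elim exE conjE)
  have "\<forall>n. \<exists>a. a \<in> V n \<and> u n = W a" using u(1) by (simp add: image_iff Bex_def)
  then obtain v where "\<forall>n. v n \<in> V n \<and> u n = W (v n)" by (rule choice[THEN exE])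
  then have v: "\<And>n. v n \<in> V n" "\<And>n. u n = W (v n)" by simp_all
  have vD: "v n \<in> D" for n using v(1)[of n] by (simp add: V_def)
  obtain w where w: "u \<longlonglongrightarrow> w"
    using u(2) unfolding Cauchy_convergent_iff convergent_def by (elim exE)
  have "u n \<in> X" for n using W_bij vD v(2) by (auto simp: bij_betw_def)
  then have "w \<in> X" by (rule closed_sequentially[OF X(2) _ w])
  then obtain x where x: "x \<in> D" "W x = w" using W_bij unfolding bij_betw_def by blast
  have small: "(\<lambda>n. 1 / real (Suc n)) \<longlonglongrightarrow> 0" by (rule LIMSEQ_Suc[OF lim_1_over_n])
  have v0: "v \<longlonglongrightarrow> 0"
    by (rule Lim_null_comparison[OF always_eventually[OF allI] small]) (use v(1) in \<open>simp add: V_def\<close>)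
  have uw: "(\<lambda>n. norm (u n - w)) \<longlonglongrightarrow> 0" by (intro tendsto_norm_zero LIM_zero w)
  have Wd: "W (v n - x) = u n - w" for n
    using vD[of n] x by (simp add: W_def T' flip: v(2)) (simp add: W_def v(2) flip: x(2))
  have vx: "v n - x \<in> D" for n using vD x by (simp add: S')
  \<comment> \<open>The lower bound for \<open>W\<close> turns convergence of \<open>W (v n)\<close>
    to \<open>W x\<close> into convergence of \<open>v n\<close> to \<open>x\<close>.\<close>
  have vx0: "(\<lambda>n. v n - x) \<longlonglongrightarrow> 0"
    by (rule Lim_null_comparison[OF always_eventually[OF allI] tendsto_mult_right_zero[OF uw, of C]])
      (use C[OF vx] Wd in simp)
  \<comment> \<open>\<open>v n\<close> tends to \<open>x\<close> and, by the choice of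
    \<open>V n\<close>, to 0. With \<open>x = 0\<close> the relative bound \<open>M\<close> forces
    \<open>K (v n)\<close> to 0, although it tends to \<open>g\<close>.\<close>
  have "x = 0" by (rule LIMSEQ_unique[OF LIM_zero_cancel[OF vx0] v0])
  then have "norm (K (v n)) \<le> M * norm (u n - w)" for n
    using M[OF vx[of n]] Wd[of n] by simp
  then have Kv0: "(\<lambda>n. K (v n)) \<longlonglongrightarrow> 0"
    by (rule Lim_null_comparison[OF always_eventually[OF allI] tendsto_mult_right_zero[OF uw, of M]])
  have Kvg: "(\<lambda>n. K (v n)) \<longlonglongrightarrow> g"
    by (rule LIM_zero_cancel, rule Lim_null_comparison[OF always_eventually[OF allI] small])
      (use v(1) in \<open>simp add: V_def dist_norm\<close>)
  have "g = 0" by (rule LIMSEQ_unique[OF Kvg Kv0])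
  then show False using ng by simp
qed

section \<open>Orthogonal projections\<close>

lemma orth_projD:
  assumes "orth_proj P"
  shows "P (P x) = P x" "P (x + y) = P x + P y" "P (x - y) = P x - P y" "P (- x) = - P x"
    "P 0 = 0" "P (scaleC c x) = scaleC c (P x)" "P (r *\<^sub>R x) = r *\<^sub>R P x"
    "cinner (P x) y = cinner x (P y)"
  using assms clinear_onD[of UNIV P] by (simp_all add: orth_proj_def)

lemma orth_proj_range_iff:
  assumes "orth_proj P"
  shows "x \<in> range P \<longleftrightarrow> P x = x" "x \<in> range (\<lambda>x. x - P x) \<longleftrightarrow> P x = 0"
proof -
  show "x \<in> range P \<longleftrightarrow> P x = x"
  proof
    assume "P x = x"
    then show "x \<in> range P" by (intro range_eqI[of _ P x]) simp
  qed (auto simp: orth_projD[OF assms])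
  show "x \<in> range (\<lambda>x. x - P x) \<longleftrightarrow> P x = 0"
  proof
    assume "P x = 0"
    then have "x = x - P x" by simp
    then show "x \<in> range (\<lambda>x. x - P x)" by (rule range_eqI)
  qed (auto simp: orth_projD[OF assms])
qed

lemma cinner_zero [simp]: "cinner 0 x = 0" "cinner x (0::'a::chilbert) = 0"
  using cinner_scaleC_left[of 0 x x] cinner_scaleC_right[of x 0 x] by simp_all

lemma orth_proj_orthogonal:
  assumes "orth_proj P" "P a = a" "P b = 0"
  shows "cinner a b = 0" "cinner b a = 0"
proof -
  show "cinner b a = 0" "cinner a b = 0"
    using orth_projD(8)[OF assms(1), of b a] orth_projD(8)[OF assms(1), of a b] assms(2,3)
    by simp_all
qed

lemma orth_proj_norm:
  assumes "orth_proj P"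
  shows "(norm x)\<^sup>2 = (norm (P x))\<^sup>2 + (norm (x - P x))\<^sup>2" "norm (P x) \<le> norm x" "norm (x - P x) \<le> norm x"
proof -
  have "Re (cinner (P x) (x - P x)) = 0"
    using orth_proj_orthogonal(1)[OF assms, of "P x" "x - P x"] by (simp add: orth_projD[OF assms])
  then show eq: "(norm x)\<^sup>2 = (norm (P x))\<^sup>2 + (norm (x - P x))\<^sup>2"
    using norm_add_square[of "P x" "x - P x"] by simp
  show "norm (P x) \<le> norm x" by (rule power2_le_imp_le) (use eq in auto)
  show "norm (x - P x) \<le> norm x" by (rule power2_le_imp_le) (use eq in auto)
qed

lemma orth_proj_bounded_linear:
  assumes "orth_proj P"
  shows "bounded_linear P"
  by (rule bounded_linear_intro[where K = 1]) (simp_all add: orth_projD[OF assms] orth_proj_norm[OF assms])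

lemma Re_cinner_Jop:
  assumes "orth_proj P"
  shows "Re (cinner (Jop P x) x) = (norm (P x))\<^sup>2 - (norm (x - P x))\<^sup>2"
proof -
  have "cinner (Jop P x) (P x + (x - P x)) = cinner (P x) (P x) - cinner (x - P x) (x - P x)"
    unfolding Jop_def cinner_add_right cinner_diff_left[of "P x" "x - P x"]
    using orth_proj_orthogonal[OF assms, of "P x" "x - P x"] by (simp add: orth_projD[OF assms])
  then show ?thesis by (simp add: Re_cinner_self)
qed

lemma Jop_Jop:
  assumes "orth_proj P"
  shows "Jop P (Jop P x) = x"
  by (simp add: Jop_def orth_projD[OF assms])

lemma orth_proj_ranges:
  assumes "orth_proj P"
  shows "csubspace (range P)" "closed (range P)"
    "csubspace (range (\<lambda>x. x - P x))" "closed (range (\<lambda>x. x - P x))"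
proof -
  note P = orth_projD[OF assms]
  have 1: "range P = {x. P x = x}" "range (\<lambda>x. x - P x) = {x. P x = 0}"
    using orth_proj_range_iff[OF assms] by auto
  show "csubspace (range P)" "csubspace (range (\<lambda>x. x - P x))"
    unfolding 1 by (simp_all add: csubspace_def P)
  have "continuous_on UNIV P"
    using bounded_linear.continuous_on[OF orth_proj_bounded_linear[OF assms] continuous_on_id] .
  then show "closed (range P)" "closed (range (\<lambda>x. x - P x))"
    unfolding 1 by (auto intro!: closed_Collect_eq)
qed

text \<open>By continuity of the indefinite form the closure of \<open>L\<close> is again
  nonnegative, so maximality makes it equal to \<open>L\<close>.\<close>

lemma max_nonneg_subspace_closed:
  assumes P: "orth_proj P" and L: "max_nonneg_subspace P L"
  shows "closed L"
proof -
  have sub: "csubspace L" and nn: "\<And>x. x \<in> L \<Longrightarrow> 0 \<le> Re (cinner (Jop P x) x)"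
    using L by (auto simp: max_nonneg_subspace_def nonneg_subspace_def)
  have P_cont: "continuous_on UNIV P"
    using bounded_linear.continuous_on[OF orth_proj_bounded_linear[OF P] continuous_on_id] .
  have "closed {x. 0 \<le> Re (cinner (Jop P x) x)}"
    unfolding Re_cinner_Jop[OF P] by (intro closed_Collect_le continuous_intros P_cont)
  then have "closure L \<subseteq> {x. 0 \<le> Re (cinner (Jop P x) x)}"
    using nn by (intro closure_minimal) auto
  then have "nonneg_subspace P (closure L)"
    using csubspace_closure[OF sub] by (auto simp: nonneg_subspace_def)
  then have "closure L = L"
    using L closure_subset[of L] by (simp add: max_nonneg_subspace_def)
  then show ?thesis by (simp only: closure_eq)
qed

section \<open>The Schur complement of a block operator\<close>

text \<open>The standing assumptions on the blocks together with hypothesis (i); (ii) and (iii)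
  appear as premises of the lemmas that use them.\<close>

locale block_operator =
  fixes P :: "'a::chilbert \<Rightarrow> 'a" and Dp Dm :: "'a set" and A :: "'a \<Rightarrow> 'a"
  assumes proj: "orth_proj P"
    and Dp: "csubspace Dp" "Dp \<subseteq> range P"
    and Dm: "csubspace Dm" "Dm \<subseteq> range (\<lambda>x. x - P x)"
    and dense: "closure {x + y | x y. x \<in> Dp \<and> y \<in> Dm} = UNIV"
    and lin: "clinear_on {x + y | x y. x \<in> Dp \<and> y \<in> Dm} A"
    and JA_diss: "dissipative_op {x + y | x y. x \<in> Dp \<and> y \<in> Dm} (\<lambda>x. Jop P (A x))"
    and A22_diss: "m_dissipative (range (\<lambda>x. x - P x)) Dm (\<lambda>x. - (A x - P (A x)))"
begin

abbreviation Q :: "'a \<Rightarrow> 'a" where "Q x \<equiv> x - P x"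

definition F :: "complex \<Rightarrow> 'a \<Rightarrow> 'a" where
  "F \<mu> p = res Dm (\<lambda>x. Q (A x)) \<mu> (Q (A p))"

definition S :: "complex \<Rightarrow> 'a \<Rightarrow> 'a" where
  "S \<mu> p = P (A p) - P (A (F \<mu> p))"

lemmas P_simps [simp] = orth_projD(1-7)[OF proj]

lemma P_Dp: "p \<in> Dp \<Longrightarrow> P p = p" and P_Dm: "q \<in> Dm \<Longrightarrow> P q = 0"
  using subsetD[OF Dp(2), of p] subsetD[OF Dm(2), of q] orth_proj_range_iff[OF proj] by simp_all

lemma Dp_D: "p \<in> Dp \<Longrightarrow> p \<in> {x + y | x y. x \<in> Dp \<and> y \<in> Dm}"
  using csubspaceD(1)[OF Dm(1)] by (intro CollectI exI[of _ p] exI[of _ 0]) simp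

lemma Dm_D: "q \<in> Dm \<Longrightarrow> q \<in> {x + y | x y. x \<in> Dp \<and> y \<in> Dm}"
  using csubspaceD(1)[OF Dp(1)] by (intro CollectI exI[of _ 0] exI[of _ q]) simp

lemma A_add: "p \<in> Dp \<Longrightarrow> q \<in> Dm \<Longrightarrow> A (p + q) = A p + A q"
  by (rule clinear_onD(2)[OF lin Dp_D Dm_D])

lemma A_diff: "p \<in> Dp \<Longrightarrow> q \<in> Dm \<Longrightarrow> A (p - q) = A p - A q"
  by (rule clinear_onD(6)[OF lin Dp_D Dm_D])

lemma clinear_on_A: "clinear_on Dp A" "clinear_on Dm A"
  unfolding clinear_on_def
  by (intro conjI ballI allI Dp(1) Dm(1) clinear_onD(2)[OF lin] clinear_onD(3)[OF lin];
      erule Dp_D Dm_D)+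

lemma clinear_on_PA: "clinear_on E A \<Longrightarrow> clinear_on E (\<lambda>x. P (A x))"
  and clinear_on_QA: "clinear_on E A \<Longrightarrow> clinear_on E (\<lambda>x. Q (A x))"
  by (simp_all add: clinear_on_def scaleC_diff_right)

lemma in_resolvent_A22:
  assumes "Re \<mu> < 0"
  shows "in_resolvent (range (\<lambda>x. x - P x)) Dm (\<lambda>x. Q (A x)) \<mu>"
  using in_resolvent_uminus[of "range (\<lambda>x. x - P x)" Dm "\<lambda>x. Q (A x)" "- \<mu>"]
    A22_diss assms orth_proj_ranges(3)[OF proj] by (simp add: m_dissipative_def)

lemma F_props:
  assumes "Re \<mu> < 0"
  shows "F \<mu> p \<in> Dm" "Q (A (F \<mu> p)) - scaleC \<mu> (F \<mu> p) = Q (A p)"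
  using res_in_resolvent[OF in_resolvent_A22[OF assms] rangeI, of "A p"] by (simp_all add: F_def)

lemma clinear_on_F: "Re \<mu> < 0 \<Longrightarrow> clinear_on Dp (F \<mu>)"
  unfolding F_def
  by (intro clinear_on_res_comp[OF in_resolvent_A22] clinear_on_QA clinear_on_A) auto

lemma clinear_on_S:
  assumes "Re \<mu> < 0"
  shows "clinear_on Dp (S \<mu>)"
  unfolding clinear_on_def S_def
  by (simp add: Dp(1) clinear_onD(2,3)[OF clinear_on_A(1)] clinear_onD(2,3)[OF clinear_on_A(2)]
      clinear_onD(2,3)[OF clinear_on_F[OF assms]] F_props(1)[OF assms] scaleC_diff_right)

text \<open>Testing the dissipativity of \<open>JA\<close> on \<open>p - F(\<mu>) p\<close>, where the second component of
  \<open>A (p - F(\<mu>) p)\<close> is \<open>- \<mu> F(\<mu>) p\<close>.\<close>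

lemma dissipative_S:
  assumes "Re \<mu> < 0"
  shows "dissipative_op Dp (S \<mu>)"
  unfolding dissipative_op_def
proof
  fix p assume p: "p \<in> Dp"
  let ?f = "F \<mu> p"
  have f: "?f \<in> Dm" "Q (A ?f) - scaleC \<mu> ?f = Q (A p)" by (rule F_props[OF assms])+
  have "p - ?f \<in> {x + y | x y. x \<in> Dp \<and> y \<in> Dm}"
    using p f(1) csubspaceD(4)[OF Dm(1)] by (intro CollectI exI[of _ p] exI[of _ "- ?f"]) simp
  then have le: "Re (cinner (Jop P (A (p - ?f))) (p - ?f)) \<le> 0"
    using JA_diss by (simp add: dissipative_op_def)
  have "Jop P (A (p - ?f)) = S \<mu> p + scaleC \<mu> ?f"
    using f(2) by (simp add: A_diff[OF p f(1)] Jop_def S_def algebra_simps)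
  moreover have "cinner (S \<mu> p) ?f = 0"
    by (rule orth_proj_orthogonal[OF proj]) (simp_all add: S_def P_Dm f)
  moreover have "cinner ?f p = 0"
    by (rule orth_proj_orthogonal[OF proj]) (simp_all add: P_Dp P_Dm f p)
  ultimately have "Re (cinner (S \<mu> p) p) - Re (\<mu> * cinner ?f ?f) \<le> 0"
    using le by (simp add: cinner_simps cinner_scaleC_left)
  \<comment> \<open>Since this inner product is real, the real part of its product with
    \<open>\<mu>\<close> involves only \<open>Re \<mu>\<close>.\<close>
  moreover have "Im (cinner ?f ?f) = 0"
    using arg_cong[OF cinner_commute[of ?f ?f], of Im] by simp
  ultimately have "Re (cinner (S \<mu> p) p) \<le> Re \<mu> * (norm ?f)\<^sup>2"
    by (simp add: Re_cinner_self)
  also have "\<dots> \<le> 0" using assms by (simp add: mult_nonpos_nonneg)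
  finally show "Re (cinner (S \<mu> p) p) \<le> 0" .
qed

text \<open>The continuous map \<open>P\<close> carries the dense domain of A into
  \<open>Dp\<close>.\<close>

lemma Dp_dense: "range P \<subseteq> closure Dp"
proof -
  have "P ` closure {x + y | x y. x \<in> Dp \<and> y \<in> Dm} \<subseteq> closure Dp"
  proof (rule image_closure_subset)
    show "continuous_on (closure {x + y | x y. x \<in> Dp \<and> y \<in> Dm}) P"
      by (rule linear_continuous_on[OF orth_proj_bounded_linear[OF proj]])
    show "P ` {x + y | x y. x \<in> Dp \<and> y \<in> Dm} \<subseteq> closure Dp"
      using closure_subset[of Dp] by (auto simp: P_Dp P_Dm)
  qed simp
  then show ?thesis unfolding dense .
qed

text \<open>\<open>closure_fun\<close> picks an arbitrary value over \<open>p\<close>. Dissipativity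
  and density make the Schur complement closable, so the only value over a point of
  \<open>Dp\<close> is the original one; this brings assumption (a) back from the closure to
  \<open>Dp\<close>.\<close>

lemma closure_fun_S:
  assumes "Re \<mu> < 0" "p \<in> Dp"
  shows "p \<in> closure_dom Dp (S \<mu>)" "closure_fun Dp (S \<mu>) p = S \<mu> p"
proof -
  have *: "(p, S \<mu> p) \<in> closure (op_graph Dp (S \<mu>))"
    using assms(2) closure_subset[of "op_graph Dp (S \<mu>)"] by (auto simp: op_graph_def)
  then show "p \<in> closure_dom Dp (S \<mu>)" by (auto simp: closure_dom_def)
  have "(p, closure_fun Dp (S \<mu>) p) \<in> closure (op_graph Dp (S \<mu>))"
    unfolding closure_fun_def using * by (rule someI)
  moreover have "S \<mu> ` Dp \<subseteq> range P"
    by (auto simp: orth_proj_range_iff(1)[OF proj] S_def)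
  ultimately show "closure_fun Dp (S \<mu>) p = S \<mu> p"
    by (intro dissipative_closable[OF clinear_on_S[OF assms(1)] dissipative_S[OF assms(1)]
      orth_proj_ranges(2,1)[OF proj] Dp_dense _ assms(2)])
qed

text \<open>Compactness of G(-1) makes A12 small relative to A22 + t for a suitable t.\<close>

lemma A12_small:
  assumes "compact_op (range (\<lambda>x. x - P x)) (\<lambda>y. P (A (res Dm (\<lambda>x. Q (A x)) (- 1) y)))" "0 < d"
  shows "\<exists>t>0. \<forall>q\<in>Dm. norm (P (A q)) \<le> d * norm (Q (A q) + t *\<^sub>R q)"
  by (rule compact_resolvent_decay[OF A22_diss orth_proj_ranges(3,4)[OF proj]
      clinear_on_QA[OF clinear_on_A(2)] clinear_on_PA[OF clinear_on_A(2)] assms])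

text \<open>Elimination of the second component. With f = F(-t) p, the first row gives (S(-t) - l) p
  = P (A x - l x) - A12 (q + f), while the second row gives (A22 + t)(q + f) = Q (A x + t x). The
  smallness of A12 relative to A22 + t therefore bounds the remainder.\<close>

lemma block_estimate:
  assumes d: "\<forall>q\<in>Dm. norm (P (A q)) \<le> d * norm (Q (A q) + t *\<^sub>R q)" and t: "0 < t"
    and Sb: "c * norm p \<le> norm (S (- complex_of_real t) p - scaleC l p)"
    and p: "p \<in> Dp" and q: "q \<in> Dm" and x: "x = p + q"
  shows "c * norm (P x) \<le> norm (P (A x - scaleC l x)) + d * norm (Q (A x + t *\<^sub>R x))"
proof -
  let ?f = "F (- complex_of_real t) p"
  have f: "?f \<in> Dm" "Q (A ?f) - scaleC (- complex_of_real t) ?f = Q (A p)"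
    by (rule F_props, use t in simp)+
  have q': "q + ?f \<in> Dm" using q f(1) by (rule csubspaceD[OF Dm(1)])
  have Px: "P x = p" by (simp add: x P_Dp P_Dm p q)
  have Aqf: "A (q + ?f) = A q + A ?f" by (rule clinear_onD(2)[OF clinear_on_A(2) q f(1)])
  have eq1: "S (- complex_of_real t) p - scaleC l p = P (A x - scaleC l x) - P (A (q + ?f))"
    unfolding P_simps Px by (simp add: x S_def A_add p q Aqf)
  have "Q (A (q + ?f)) + t *\<^sub>R (q + ?f) = Q (A q) + t *\<^sub>R q + Q (A p)"
    unfolding f(2)[symmetric] by (simp add: Aqf scaleC_minus_of_real algebra_simps)
  also have "\<dots> = Q (A x + t *\<^sub>R x)"
    by (simp add: x A_add p q P_Dp P_Dm algebra_simps)
  finally have "norm (P (A (q + ?f))) \<le> d * norm (Q (A x + t *\<^sub>R x))"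
    using d q' by metis
  then show ?thesis
    using Sb norm_triangle_ineq4[of "P (A x - scaleC l x)" "P (A (q + ?f))"]
    unfolding Px eq1 by linarith
qed

end

section \<open>Lower bounds for the Schur complement under (a) and (b)\<close>

lemma generates_qh_semigroupD:
  assumes "generates_qh_semigroup X D T"
  shows "0 < \<epsilon> \<Longrightarrow> \<exists>C>0. \<forall>l. \<epsilon> < Re l \<longrightarrow> (\<forall>x\<in>D. cmod l * norm x \<le> C * norm (T x - scaleC l x))"
    and "0 < Re l \<Longrightarrow> in_resolvent X D T l"
proof -
  have *: "\<forall>\<epsilon>>0. (\<forall>l. \<epsilon> < Re l \<longrightarrow> in_resolvent X D T l)
      \<and> (\<exists>C. \<forall>l. \<epsilon> < Re l \<longrightarrow> (\<forall>x\<in>D. cmod l * norm x \<le> C * norm (T x - scaleC l x)))"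
    using assms by (simp add: generates_qh_semigroup_def)
  show "in_resolvent X D T l" if "0 < Re l"
    \<comment> \<open>Halving \<open>Re l\<close> gives an admissible \<epsilon> strictly below
      it.\<close>
    using *[rule_format, of "Re l / 2"] that by simp
  assume "0 < \<epsilon>"
  with * obtain C where C: "\<forall>l. \<epsilon> < Re l \<longrightarrow> (\<forall>x\<in>D. cmod l * norm x \<le> C * norm (T x - scaleC l x))"
    by meson
  show "\<exists>C>0. \<forall>l. \<epsilon> < Re l \<longrightarrow> (\<forall>x\<in>D. cmod l * norm x \<le> C * norm (T x - scaleC l x))"
  proof (intro exI[of _ "max C 1"] conjI allI impI ballI)
    fix l x assume "\<epsilon> < Re l" "x \<in> D"
    then have "cmod l * norm x \<le> C * norm (T x - scaleC l x)" using C by simp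
    also have "\<dots> \<le> max C 1 * norm (T x - scaleC l x)" by (rule mult_right_mono) simp_all
    finally show "cmod l * norm x \<le> max C 1 * norm (T x - scaleC l x)" .
  qed simp
qed

context block_operator
begin

text \<open>\<open>k\<close> is fixed before \<open>d\<close>, while \<open>t\<close> and
  \<open>M\<close> may depend on \<open>d\<close>; the later absorption needs \<open>d\<close> below
  \<open>k\<close>. Write \<nu> for -t. By the resolvent identity, (A22 - \<mu>)(F(\<nu>) -
  F(\<mu>)) = (\<nu> - \<mu>) F(\<nu>), so S(\<nu>) - S(\<mu>) is the bounded operator -(\<nu> -
  \<mu>) G(\<mu>) F(\<nu>), and only \<open>M\<close> absorbs the change from \<mu> to -t.\<close>

lemma S_bound_closure_generator:
  assumes comp: "\<And>\<nu>. Re \<nu> < 0 \<Longrightarrow>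
        compact_op (range (\<lambda>x. x - P x)) (\<lambda>y. P (A (res Dm (\<lambda>x. Q (A x)) \<nu> y)))"
    and bdd: "\<And>\<nu>. Re \<nu> < 0 \<Longrightarrow> bounded_on Dp (F \<nu>)"
    and \<mu>: "Re \<mu> < 0"
    and gen: "generates_qh_semigroup (range P) (closure_dom Dp (S \<mu>)) (closure_fun Dp (S \<mu>))"
    and \<epsilon>: "0 < \<epsilon>"
  shows "\<exists>k>0. \<forall>d>0. \<exists>t>0. \<exists>M. (\<forall>q\<in>Dm. norm (P (A q)) \<le> d * norm (Q (A q) + t *\<^sub>R q)) \<and>
    (\<forall>p\<in>Dp. \<forall>l. \<epsilon> < Re l \<longrightarrow>
      (k * cmod l - M) * norm p \<le> norm (S (- complex_of_real t) p - scaleC l p))"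
proof -
  obtain C where C: "0 < C" "\<forall>l. \<epsilon> < Re l \<longrightarrow> (\<forall>x\<in>closure_dom Dp (S \<mu>).
      cmod l * norm x \<le> C * norm (closure_fun Dp (S \<mu>) x - scaleC l x))"
    using generates_qh_semigroupD(1)[OF gen \<epsilon>] by (elim exE conjE)
  have S\<mu>: "1 / C * cmod l * norm p \<le> norm (S \<mu> p - scaleC l p)" if "\<epsilon> < Re l" "p \<in> Dp" for l p
  proof -
    have "cmod l * norm p \<le> C * norm (S \<mu> p - scaleC l p)"
      using C(2)[rule_format, OF that(1) closure_fun_S(1)[OF \<mu> that(2)]]
      unfolding closure_fun_S(2)[OF \<mu> that(2)] .
    then show ?thesis using C(1) by (simp add: divide_le_eq mult.commute)
  qed
  obtain M2 where M2: "0 \<le> M2"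
    "\<And>q. q \<in> Dm \<Longrightarrow> norm (P (A q)) \<le> M2 * norm (Q (A q) - scaleC \<mu> q)"
    using compact_resolvent_bound[OF in_resolvent_A22[OF \<mu>] clinear_on_QA[OF clinear_on_A(2)]
        clinear_on_PA[OF clinear_on_A(2)] comp[OF \<mu>]] by auto
  show ?thesis
  proof (rule exI[of _ "1 / C"], intro conjI allI impI)
    show "0 < 1 / C" using C(1) by simp
    fix d :: real assume "0 < d"
    then obtain t where t: "0 < t" "\<forall>q\<in>Dm. norm (P (A q)) \<le> d * norm (Q (A q) + t *\<^sub>R q)"
      using A12_small[OF comp, of d] by auto
    define \<nu> where "\<nu> = - complex_of_real t"
    have \<nu>: "Re \<nu> < 0" using t(1) by (simp add: \<nu>_def)
    obtain M1 where M1: "\<And>p. p \<in> Dp \<Longrightarrow> norm (F \<nu> p) \<le> M1 * norm p"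
      using bdd[OF \<nu>] by (auto simp: bounded_on_def)
    \<comment> \<open>\<open>M2\<close> bounds G(\<mu>), compact by (iii), and \<open>M1\<close>
      bounds F(\<nu>) by (ii).\<close>
    define M where "M = M2 * (cmod (\<nu> - \<mu>) * M1)"
    have "(1 / C * cmod l - M) * norm p \<le> norm (S \<nu> p - scaleC l p)"
      if p: "p \<in> Dp" and l: "\<epsilon> < Re l" for p l
    proof -
      let ?g = "F \<nu> p - F \<mu> p"
      have g: "?g \<in> Dm" using csubspaceD(5)[OF Dm(1) F_props(1)[OF \<nu>] F_props(1)[OF \<mu>]] .
      have Ag: "A ?g = A (F \<nu> p) - A (F \<mu> p)"
        by (rule clinear_onD(6)[OF clinear_on_A(2) F_props(1)[OF \<nu>] F_props(1)[OF \<mu>]])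
      have "Q (A ?g) - scaleC \<mu> ?g
          = (Q (A (F \<nu> p)) - scaleC \<nu> (F \<nu> p)) + scaleC (\<nu> - \<mu>) (F \<nu> p)
            - (Q (A (F \<mu> p)) - scaleC \<mu> (F \<mu> p))"
        by (simp add: Ag scaleC_diff_left scaleC_diff_right)
      also have "\<dots> = scaleC (\<nu> - \<mu>) (F \<nu> p)"
        unfolding F_props(2)[OF \<nu>] F_props(2)[OF \<mu>] by simp
      finally have "norm (P (A ?g)) \<le> M2 * (cmod (\<nu> - \<mu>) * norm (F \<nu> p))"
        using M2(2)[OF g] by simp
      also have "\<dots> \<le> M2 * (cmod (\<nu> - \<mu>) * (M1 * norm p))"
        by (intro mult_left_mono M2(1) M1[OF p]) auto
      finally have le: "norm (P (A ?g)) \<le> M * norm p" by (simp add: M_def mult.assoc)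
      have "S \<nu> p - scaleC l p = (S \<mu> p - scaleC l p) - P (A ?g)"
        by (simp add: S_def Ag)
      then have "norm (S \<mu> p - scaleC l p) - norm (P (A ?g)) \<le> norm (S \<nu> p - scaleC l p)"
        by (simp only: norm_triangle_ineq2)
      then show ?thesis using le S\<mu>[OF l p] by (simp add: left_diff_distrib)
    qed
    then show "\<exists>t>0. \<exists>M. (\<forall>q\<in>Dm. norm (P (A q)) \<le> d * norm (Q (A q) + t *\<^sub>R q)) \<and>
      (\<forall>p\<in>Dp. \<forall>l. \<epsilon> < Re l \<longrightarrow>
        (1 / C * cmod l - M) * norm p \<le> norm (S (- complex_of_real t) p - scaleC l p))"
      using t unfolding \<nu>_def by (intro exI[of _ t] exI[of _ M] conjI) auto
  qed
qed

text \<open>The correction A12 F(-t) is small relative to A11: A12 contributes a small factor e, and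
  (b) bounds A21 p by (A11 - \<alpha>) p, which differs from (A11 - l) p by at most (|l| +
  |\<alpha>|) |p| in norm.\<close>

lemma S_bound_A11_generator:
  assumes comp: "compact_op (range (\<lambda>x. x - P x)) (\<lambda>y. P (A (res Dm (\<lambda>x. Q (A x)) (- 1) y)))"
    and gen: "generates_qh_semigroup (range P) Dp (\<lambda>x. P (A x))"
    and \<alpha>: "0 < Re \<alpha>" "bounded_on (range P) (\<lambda>y. Q (A (res Dp (\<lambda>x. P (A x)) \<alpha> y)))"
    and \<epsilon>: "0 < \<epsilon>"
  shows "\<exists>k>0. \<forall>d>0. \<exists>t>0. \<exists>M. (\<forall>q\<in>Dm. norm (P (A q)) \<le> d * norm (Q (A q) + t *\<^sub>R q)) \<and>
    (\<forall>p\<in>Dp. \<forall>l. \<epsilon> < Re l \<longrightarrow>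
      (k * cmod l - M) * norm p \<le> norm (S (- complex_of_real t) p - scaleC l p))"
proof -
  obtain C where C: "0 < C" and C': "\<forall>l. \<epsilon> < Re l \<longrightarrow>
      (\<forall>x\<in>Dp. cmod l * norm x \<le> C * norm (P (A x) - scaleC l x))"
    using generates_qh_semigroupD(1)[OF gen \<epsilon>] by (elim exE conjE)
  note C_le = C'[rule_format]
  have R: "in_resolvent (range P) Dp (\<lambda>x. P (A x)) \<alpha>"
    by (rule generates_qh_semigroupD(2)[OF gen \<alpha>(1)])
  obtain B where B: "\<And>y. y \<in> range P \<Longrightarrow> norm (Q (A (res Dp (\<lambda>x. P (A x)) \<alpha> y))) \<le> B * norm y"
    using \<alpha>(2) by (auto simp: bounded_on_def)
  define B' where "B' = max B 1"
  have B': "0 < B'" by (simp add: B'_def)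
  have B_le: "norm (Q (A p)) \<le> B' * norm (P (A p) - scaleC \<alpha> p)" if p: "p \<in> Dp" for p
  proof -
    have "P (A p) - scaleC \<alpha> p \<in> range P"
      using p by (simp add: orth_proj_range_iff[OF proj] P_Dp)
    from B[OF this] have "norm (Q (A p)) \<le> B * norm (P (A p) - scaleC \<alpha> p)"
      unfolding res_eqI[OF R p refl] .
    also have "\<dots> \<le> B' * norm (P (A p) - scaleC \<alpha> p)"
      by (rule mult_right_mono) (simp_all add: B'_def)
    finally show ?thesis .
  qed
  show ?thesis
  proof (rule exI[of _ "1 / (4 * C)"], intro conjI allI impI)
    show "0 < 1 / (4 * C)" using C by simp
    fix d :: real assume d: "0 < d"
    \<comment> \<open>The first bound gives the estimate required for \<open>d\<close>; the second
      lets half of |(A11 - l) p| survive; the third keeps the loss in |l| |p| at 1/(4 C). Since half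
      of |(A11 - l) p| is at least |l| |p| / (2 C), the coefficient 1/(4 C) remains.\<close>
    define e where "e = min d (min (1 / (2 * B')) (1 / (4 * C * B')))"
    have e: "0 < e" "e \<le> d" using d C B' by (simp_all add: e_def)
    have "e \<le> 1 / (2 * B')" "e \<le> 1 / (4 * C * B')" by (simp_all add: e_def)
    then have eB: "e * B' \<le> 1 / 2" "e * B' \<le> 1 / (4 * C)"
      using B' C by (simp_all add: pos_le_divide_eq mult.assoc mult.left_commute mult.commute)
    obtain t where t: "0 < t" "\<forall>q\<in>Dm. norm (P (A q)) \<le> e * norm (Q (A q) + t *\<^sub>R q)"
      using A12_small[OF comp e(1)] by auto
    define \<nu> where "\<nu> = - complex_of_real t"
    have \<nu>: "Re \<nu> < 0" using t(1) by (simp add: \<nu>_def)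
    define M where "M = e * B' * cmod \<alpha>"
    have "(1 / (4 * C) * cmod l - M) * norm p \<le> norm (S \<nu> p - scaleC l p)"
      if p: "p \<in> Dp" and l: "\<epsilon> < Re l" for p l
    proof -
      let ?N = "norm (P (A p) - scaleC l p)"
      have "norm (P (A (F \<nu> p))) \<le> e * norm (Q (A (F \<nu> p)) + t *\<^sub>R F \<nu> p)"
        using t(2) F_props(1)[OF \<nu>] by blast
      also have "Q (A (F \<nu> p)) + t *\<^sub>R F \<nu> p = Q (A p)"
        using F_props(2)[OF \<nu>, of p] by (simp add: \<nu>_def scaleC_minus_of_real)
      also have "e * norm (Q (A p)) \<le> e * (B' * norm (P (A p) - scaleC \<alpha> p))"
        using e(1) B_le[OF p] by (intro mult_left_mono) auto
      also have "\<dots> \<le> e * (B' * (?N + cmod l * norm p + cmod \<alpha> * norm p))"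
      proof -
        have "norm (P (A p) - scaleC \<alpha> p) \<le> ?N + norm (scaleC l p) + norm (scaleC \<alpha> p)"
          using norm_triangle_ineq[of "P (A p) - scaleC l p" "scaleC l p"]
            norm_triangle_ineq4[of "P (A p)" "scaleC \<alpha> p"] by simp
        then show ?thesis using e(1) B' by (intro mult_left_mono) auto
      qed
      also have "\<dots> = e * B' * ?N + e * B' * (cmod l * norm p) + M * norm p"
        by (simp add: M_def algebra_simps)
      also have "\<dots> \<le> 1 / 2 * ?N + 1 / (4 * C) * (cmod l * norm p) + M * norm p"
        by (intro add_mono mult_right_mono eB) auto
      finally have le: "norm (P (A (F \<nu> p))) \<le> 1 / 2 * ?N + 1 / (4 * C) * (cmod l * norm p) + M * norm p" .
      have "1 / C * (cmod l * norm p) \<le> ?N"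
        using C_le[OF l p] C by (simp add: divide_le_eq mult.commute)
      moreover have "1 / (4 * C) * (cmod l * norm p) = 1 / 4 * (1 / C * (cmod l * norm p))"
        by simp
      moreover have "S \<nu> p - scaleC l p = (P (A p) - scaleC l p) - P (A (F \<nu> p))"
        by (simp add: S_def)
      then have "?N - norm (P (A (F \<nu> p))) \<le> norm (S \<nu> p - scaleC l p)"
        by (simp only: norm_triangle_ineq2)
      ultimately show ?thesis using le by (simp add: left_diff_distrib)
    qed
    moreover have "norm (P (A q)) \<le> d * norm (Q (A q) + t *\<^sub>R q)" if "q \<in> Dm" for q
      by (rule order_trans[OF t(2)[rule_format, OF that]], rule mult_right_mono) (simp_all add: e)
    ultimately show "\<exists>t>0. \<exists>M. (\<forall>q\<in>Dm. norm (P (A q)) \<le> d * norm (Q (A q) + t *\<^sub>R q)) \<and>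
      (\<forall>p\<in>Dp. \<forall>l. \<epsilon> < Re l \<longrightarrow>
        (1 / (4 * C) * cmod l - M) * norm p \<le> norm (S (- complex_of_real t) p - scaleC l p))"
      using t(1) unfolding \<nu>_def by (intro exI[of _ t] exI[of _ M] conjI) auto
  qed
qed

section \<open>The estimate on the closure of A and the absorption for large l\<close>

text \<open>Once expressed through \<open>x\<close> and \<open>y\<close> alone, both sides are
  continuous, so the block estimate passes to limits of the graph without splitting the limit point
  into components from \<open>Dp\<close> and \<open>Dm\<close>.\<close>

lemma closure_estimate:
  assumes d: "\<forall>q\<in>Dm. norm (P (A q)) \<le> d * norm (Q (A q) + t *\<^sub>R q)" and t: "0 < t"
    and Sb: "\<And>p. p \<in> Dp \<Longrightarrow> c * norm p \<le> norm (S (- complex_of_real t) p - scaleC l p)"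
    and xy: "(x, y) \<in> closure (op_graph {x + y | x y. x \<in> Dp \<and> y \<in> Dm} A)"
  shows "c * norm (P x) \<le> norm (P (y - scaleC l x)) + d * norm (Q (y + t *\<^sub>R x))"
proof -
  obtain z where z: "\<And>n. z n \<in> op_graph {x + y | x y. x \<in> Dp \<and> y \<in> Dm} A" and lim: "z \<longlonglongrightarrow> (x, y)"
    using xy unfolding closure_sequential by blast
  define u where "u n = fst (z n)" for n
  have zu: "z n = (u n, A (u n))" and uD: "\<exists>p q. p \<in> Dp \<and> q \<in> Dm \<and> u n = p + q" for n
    using z[of n] by (auto simp: op_graph_def u_def)
  have u: "u \<longlonglongrightarrow> x" and Au: "(\<lambda>n. A (u n)) \<longlonglongrightarrow> y"
    using tendsto_fst[OF lim] tendsto_snd[OF lim] by (simp_all add: zu)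
  note P_lim = bounded_linear.tendsto[OF orth_proj_bounded_linear[OF proj]]
  show ?thesis
  proof (rule LIMSEQ_le)
    show "(\<lambda>n. c * norm (P (u n))) \<longlonglongrightarrow> c * norm (P x)"
      by (intro tendsto_mult tendsto_const tendsto_norm P_lim u)
    show "(\<lambda>n. norm (P (A (u n) - scaleC l (u n))) + d * norm (Q (A (u n) + t *\<^sub>R u n)))
        \<longlonglongrightarrow> norm (P (y - scaleC l x)) + d * norm (Q (y + t *\<^sub>R x))"
      by (intro tendsto_add tendsto_mult tendsto_const tendsto_norm P_lim tendsto_diff
          tendsto_scaleC tendsto_scaleR u Au)
    have "c * norm (P (u n)) \<le> norm (P (A (u n) - scaleC l (u n))) + d * norm (Q (A (u n) + t *\<^sub>R u n))" for n
    proof -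
      obtain p q where "p \<in> Dp" "q \<in> Dm" "u n = p + q" using uD by blast
      then show ?thesis by (intro block_estimate[OF d t Sb])
    qed
    then show "\<exists>N. \<forall>n\<ge>N. c * norm (P (u n))
        \<le> norm (P (A (u n) - scaleC l (u n))) + d * norm (Q (A (u n) + t *\<^sub>R u n))" by blast
  qed
qed

text \<open>Since Q (y + t x) = Q (y - l x) + (l + t) Q x, the condition |Q x| \<le> |P x| turns the
  last term of the closure estimate into a multiple of |P x| that the left side can absorb.\<close>

lemma large_resolvent_bound:
  assumes Sb: "\<exists>k>0. \<forall>d>0. \<exists>t>0. \<exists>M. (\<forall>q\<in>Dm. norm (P (A q)) \<le> d * norm (Q (A q) + t *\<^sub>R q)) \<and>
    (\<forall>p\<in>Dp. \<forall>l. \<epsilon> < Re l \<longrightarrow>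
      (k * cmod l - M) * norm p \<le> norm (S (- complex_of_real t) p - scaleC l p))"
  shows "\<exists>R C. 0 \<le> C \<and> (\<forall>x y l. (x, y) \<in> closure (op_graph {x + y | x y. x \<in> Dp \<and> y \<in> Dm} A) \<longrightarrow>
    norm (Q x) \<le> norm (P x) \<longrightarrow> \<epsilon> < Re l \<longrightarrow> R \<le> cmod l \<longrightarrow>
    cmod l * norm x \<le> C * norm (y - scaleC l x))"
proof -
  obtain k where k: "0 < k" and k': "\<And>d. 0 < d \<Longrightarrow> \<exists>t>0. \<exists>M.
      (\<forall>q\<in>Dm. norm (P (A q)) \<le> d * norm (Q (A q) + t *\<^sub>R q)) \<and>
      (\<forall>p\<in>Dp. \<forall>l. \<epsilon> < Re l \<longrightarrow>
        (k * cmod l - M) * norm p \<le> norm (S (- complex_of_real t) p - scaleC l p))"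
    using Sb by (elim exE conjE) simp
  \<comment> \<open>Absorbing d |l| |P x| then leaves the coefficient k/2.\<close>
  define d where "d = k / 2"
  have d: "0 < d" using k by (simp add: d_def)
  obtain t M where t: "0 < t" and
    td: "\<forall>q\<in>Dm. norm (P (A q)) \<le> d * norm (Q (A q) + t *\<^sub>R q)" and
    tS: "\<forall>p\<in>Dp. \<forall>l. \<epsilon> < Re l \<longrightarrow>
      (k * cmod l - M) * norm p \<le> norm (S (- complex_of_real t) p - scaleC l p)"
    using k'[OF d] by (elim exE conjE)
  \<comment> \<open>Beyond the threshold 4/k (M + d t), the term M + d t costs at most another k/4
    |l|, so |P x| carries k/4 |l|. This gives the factor 4/k, doubled because |x| \<le> 2 |P
    x|.\<close>
  define C where "C = 8 / k * (1 + d)"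
  have "cmod l * norm x \<le> C * norm (y - scaleC l x)"
    if xy: "(x, y) \<in> closure (op_graph {x + y | x y. x \<in> Dp \<and> y \<in> Dm} A)"
      and nn: "norm (Q x) \<le> norm (P x)" and l: "\<epsilon> < Re l" and R: "4 / k * (M + d * t) \<le> cmod l" for x y l
  proof -
    let ?w = "y - scaleC l x"
    have "Q (y + t *\<^sub>R x) = Q ?w + (scaleC l (Q x) + t *\<^sub>R Q x)"
      by (simp add: scaleC_diff_right algebra_simps)
    then have "norm (Q (y + t *\<^sub>R x)) \<le> norm (Q ?w) + norm (scaleC l (Q x) + t *\<^sub>R Q x)"
      by (simp only: norm_triangle_ineq)
    also have "norm (scaleC l (Q x) + t *\<^sub>R Q x) \<le> cmod l * norm (Q x) + t * norm (Q x)"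
      using norm_triangle_ineq[of "scaleC l (Q x)" "t *\<^sub>R Q x"] t by simp
    also have "\<dots> \<le> cmod l * norm (P x) + t * norm (P x)"
      using nn t by (intro add_mono mult_left_mono) auto
    finally have "norm (Q (y + t *\<^sub>R x)) \<le> norm ?w + (cmod l * norm (P x) + t * norm (P x))"
      using orth_proj_norm(3)[OF proj, of ?w] by linarith
    then have "d * norm (Q (y + t *\<^sub>R x)) \<le> d * (norm ?w + (cmod l * norm (P x) + t * norm (P x)))"
      using d by simp
    moreover have "(k * cmod l - M) * norm (P x) \<le> norm (P ?w) + d * norm (Q (y + t *\<^sub>R x))"
      by (rule closure_estimate[OF td t tS[rule_format, OF _ l] xy])
    ultimately have "(k * cmod l - M) * norm (P x)
        \<le> norm ?w + d * (norm ?w + (cmod l * norm (P x) + t * norm (P x)))"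
      using orth_proj_norm(2)[OF proj, of ?w] by linarith
    then have "(k / 2 * cmod l - (M + d * t)) * norm (P x) \<le> (1 + d) * norm ?w"
      by (simp add: d_def algebra_simps)
    moreover have "k / 4 * cmod l * norm (P x) \<le> (k / 2 * cmod l - (M + d * t)) * norm (P x)"
    proof (rule mult_right_mono)
      have "M + d * t \<le> k / 4 * cmod l" using R k by (simp add: field_simps)
      then show "k / 4 * cmod l \<le> k / 2 * cmod l - (M + d * t)" by simp
    qed simp
    ultimately have "k / 4 * cmod l * norm (P x) \<le> (1 + d) * norm ?w" by linarith
    then have "cmod l * norm (P x) \<le> 4 / k * (1 + d) * norm ?w"
      using k by (simp add: field_simps)
    moreover have "norm x \<le> 2 * norm (P x)"
      using norm_triangle_ineq[of "P x" "Q x"] nn by simp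
    then have "cmod l * norm x \<le> cmod l * (2 * norm (P x))"
      by (rule mult_left_mono) simp
    moreover have "C * norm ?w = 2 * (4 / k * (1 + d) * norm ?w)" by (simp add: C_def)
    ultimately show ?thesis by linarith
  qed
  moreover have "0 \<le> C" using k d by (simp add: C_def)
  ultimately show ?thesis
    by (intro exI[of _ "4 / k * (M + d * t)"] exI[of _ C] conjI allI impI)
qed

end

section \<open>From large l to the generator property, and the conclusion\<close>

text \<open>Below the threshold, l ranges over a bounded part of a half-plane whose closure lies in
  the resolvent set, where a uniform lower bound comes from compactness.\<close>

lemma generates_qh_semigroup_of_large_bound:
  assumes lin: "clinear_on D T" and X: "closed X" and D: "D \<subseteq> X" "X \<subseteq> closure D" "T ` D \<subseteq> X"
    and R: "\<And>l. 0 < Re l \<Longrightarrow> in_resolvent X D T l"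
    and large: "\<And>\<epsilon>. 0 < \<epsilon> \<Longrightarrow> \<exists>r C. 0 \<le> C \<and> (\<forall>x\<in>D. \<forall>l. \<epsilon> < Re l \<longrightarrow> r \<le> cmod l \<longrightarrow>
      cmod l * norm x \<le> C * norm (T x - scaleC l x))"
  shows "generates_qh_semigroup X D T"
  unfolding generates_qh_semigroup_def
proof (intro conjI allI impI lin D)
  show "closed_op D T" by (rule closed_op_in_resolvent[OF R[of 1] lin X]) simp
  fix \<epsilon> :: real assume \<epsilon>: "0 < \<epsilon>"
  show "in_resolvent X D T l" if "\<epsilon> < Re l" for l using R[of l] \<epsilon> that by simp
  obtain r C where C: "0 \<le> C" "\<forall>x\<in>D. \<forall>l. \<epsilon> < Re l \<longrightarrow> r \<le> cmod l \<longrightarrow>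
      cmod l * norm x \<le> C * norm (T x - scaleC l x)"
    using large[OF \<epsilon>] by (elim exE conjE)
  \<comment> \<open>Weakening to \<open>\<epsilon> \<le> Re l\<close> makes the set closed and, as
    \<epsilon> is positive, keeps it inside the open right half-plane.\<close>
  have "compact (cball 0 r \<inter> {l. \<epsilon> \<le> Re l})"
    by (intro compact_Int_closed compact_cball closed_halfspace_Re_ge)
  then have "\<exists>B. \<forall>l\<in>cball 0 r \<inter> {l. \<epsilon> \<le> Re l}. \<forall>x\<in>D. norm x \<le> B * norm (T x - scaleC l x)"
    by (rule resolvent_bound_compact[where X = X]) (use R \<epsilon> in simp)
  then obtain B where B: "\<forall>l\<in>cball 0 r \<inter> {l. \<epsilon> \<le> Re l}. \<forall>x\<in>D. norm x \<le> B * norm (T x - scaleC l x)"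
    by (elim exE)
  \<comment> \<open>The sum serves both ranges of \<open>l\<close>; absolute values are taken
    because \<open>r\<close> and \<open>B\<close> carry no sign information.\<close>
  have "cmod l * norm x \<le> (C + \<bar>r\<bar> * \<bar>B\<bar>) * norm (T x - scaleC l x)"
    if l: "\<epsilon> < Re l" and x: "x \<in> D" for l x
  proof (cases "r \<le> cmod l")
    case True
    then have "cmod l * norm x \<le> C * norm (T x - scaleC l x)" using C(2) l x by simp
    also have "\<dots> \<le> (C + \<bar>r\<bar> * \<bar>B\<bar>) * norm (T x - scaleC l x)" by (rule mult_right_mono) auto
    finally show ?thesis .
  next
    case False
    then have lr: "cmod l \<le> r" by simp
    have "norm x \<le> B * norm (T x - scaleC l x)"
      using B[rule_format, of l x] lr x l by simp
    also have "\<dots> \<le> \<bar>B\<bar> * norm (T x - scaleC l x)" by (rule mult_right_mono) auto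
    finally have "cmod l * norm x \<le> \<bar>r\<bar> * (\<bar>B\<bar> * norm (T x - scaleC l x))"
      using lr by (intro mult_mono) auto
    also have "\<dots> \<le> (C + \<bar>r\<bar> * \<bar>B\<bar>) * norm (T x - scaleC l x)"
      using C(1) by (simp add: algebra_simps)
    finally show ?thesis .
  qed
  then show "\<exists>C. \<forall>l. \<epsilon> < Re l \<longrightarrow> (\<forall>x\<in>D. cmod l * norm x \<le> C * norm (T x - scaleC l x))"
    by (intro exI[of _ "C + \<bar>r\<bar> * \<bar>B\<bar>"] allI impI ballI)
qed

lemma clinear_on_Int:
  assumes "clinear_on D T" "csubspace L"
  shows "clinear_on (D \<inter> L) T"
  using assms by (simp add: clinear_on_def csubspace_def)

text \<open>The closure of A is given by a choice function, so its linearity is recovered from that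
  of the m-dissipative operator J times the closure, J being a linear involution.\<close>

lemma clinear_on_of_Jop:
  assumes "orth_proj P" "clinear_on D (\<lambda>x. Jop P (T x))"
  shows "clinear_on D T"
proof -
  have "Jop P (x + y) = Jop P x + Jop P y" "Jop P (scaleC c x) = scaleC c (Jop P x)" for x y c
    by (simp_all add: Jop_def orth_projD[OF assms(1)] scaleC_diff_right)
  then have "clinear_on D (\<lambda>x. Jop P (Jop P (T x)))"
    using assms(2) by (simp add: clinear_on_def)
  then show ?thesis by (simp add: Jop_Jop[OF assms(1)])
qed

theorem mainTheorem13:
  fixes P :: "'a::chilbert \<Rightarrow> 'a" and Dp Dm L :: "'a set" and A :: "'a \<Rightarrow> 'a"
  defines "Pm \<equiv> \<lambda>x. x - P x"
    and "D \<equiv> {x + y | x y. x \<in> Dp \<and> y \<in> Dm}"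
    and "A11 \<equiv> \<lambda>x. P (A x)" and "A12 \<equiv> \<lambda>x. P (A x)"
    and "A21 \<equiv> \<lambda>x. (\<lambda>x. x - P x) (A x)" and "A22 \<equiv> \<lambda>x. (\<lambda>x. x - P x) (A x)"
    and "Dbar \<equiv> closure_dom {x + y | x y. x \<in> Dp \<and> y \<in> Dm} A"
    and "Abar \<equiv> closure_fun {x + y | x y. x \<in> Dp \<and> y \<in> Dm} A"
  assumes separable: "\<exists>C::'a set. countable C \<and> closure C = UNIV"
    and proj: "orth_proj P" and rk_plus: "infinite_rank P" and rk_minus: "infinite_rank Pm"
    and Dp: "csubspace Dp" "Dp \<subseteq> range P"
    and Dm: "csubspace Dm" "Dm \<subseteq> range Pm"
    and dense: "closure D = UNIV"
    and lin: "clinear_on D A"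
    and JA_diss: "dissipative_op D (\<lambda>x. Jop P (A x))"
    and hyp_i: "m_dissipative (range Pm) Dm (\<lambda>x. - A22 x)"
    and hyp_ii: "\<forall>\<mu>. Re \<mu> < 0 \<longrightarrow> bounded_on Dp (\<lambda>x. res Dm A22 \<mu> (A21 x))"
    and hyp_iii: "\<forall>\<mu>. Re \<mu> < 0 \<longrightarrow> compact_op (range Pm) (\<lambda>y. A12 (res Dm A22 \<mu> y))"
    and J_m_diss: "m_dissipative UNIV Dbar (\<lambda>x. Jop P (Abar x))"
    and L_max: "max_nonneg_subspace P L"
    and L_inv: "op_invariant Dbar Abar L"
    and spec: "\<forall>l. 0 < Re l \<longrightarrow> in_resolvent L (Dbar \<inter> L) Abar l"
    and ab: "(\<exists>\<mu>. Re \<mu> < 0 \<and>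
              generates_qh_semigroup (range P)
                (closure_dom Dp (\<lambda>x. A11 x - A12 (res Dm A22 \<mu> (A21 x))))
                (closure_fun Dp (\<lambda>x. A11 x - A12 (res Dm A22 \<mu> (A21 x)))))
           \<or> (generates_qh_semigroup (range P) Dp A11 \<and>
              (\<exists>\<alpha>0. 0 < Re \<alpha>0 \<and> bounded_on (range P) (\<lambda>y. A21 (res Dp A11 \<alpha>0 y))))"
  shows "generates_qh_semigroup L (Dbar \<inter> L) Abar"
proof -
  interpret block_operator P Dp Dm A
    by (rule block_operator.intro[OF proj Dp Dm[unfolded Pm_def] dense[unfolded D_def]
          lin[unfolded D_def] JA_diss[unfolded D_def] hyp_i[unfolded Pm_def A22_def]])
  have S_eq: "(\<lambda>x. A11 x - A12 (res Dm A22 \<mu> (A21 x))) = S \<mu>" for \<mu>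
    by (rule ext) (simp only: S_def F_def A11_def A12_def A21_def A22_def)
  have comp: "compact_op (range (\<lambda>x. x - P x)) (\<lambda>y. P (A (res Dm (\<lambda>x. Q (A x)) \<nu> y)))"
    if "Re \<nu> < 0" for \<nu>
    using hyp_iii[rule_format, OF that] by (simp only: Pm_def A12_def A22_def)
  have bdd: "bounded_on Dp (F \<nu>)" if "Re \<nu> < 0" for \<nu>
    using hyp_ii[rule_format, OF that] by (simp only: F_def[abs_def] A21_def A22_def)
  \<comment> \<open>Alternatives (a) and (b) enter only here, through one common bound.\<close>
  have Sb: "\<exists>k>0. \<forall>d>0. \<exists>t>0. \<exists>M. (\<forall>q\<in>Dm. norm (P (A q)) \<le> d * norm (Q (A q) + t *\<^sub>R q)) \<and>
      (\<forall>p\<in>Dp. \<forall>l. \<epsilon> < Re l \<longrightarrow>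
        (k * cmod l - M) * norm p \<le> norm (S (- complex_of_real t) p - scaleC l p))"
    if "0 < \<epsilon>" for \<epsilon>
    using ab
  proof (elim disjE exE conjE)
    fix \<mu> assume \<mu>: "Re \<mu> < 0" and gen: "generates_qh_semigroup (range P)
        (closure_dom Dp (\<lambda>x. A11 x - A12 (res Dm A22 \<mu> (A21 x))))
        (closure_fun Dp (\<lambda>x. A11 x - A12 (res Dm A22 \<mu> (A21 x))))"
    show ?thesis
      by (rule S_bound_closure_generator[OF comp bdd \<mu> gen[unfolded S_eq] that])
  next
    fix \<alpha> assume gen: "generates_qh_semigroup (range P) Dp A11" and \<alpha>: "0 < Re \<alpha>"
      "bounded_on (range P) (\<lambda>y. A21 (res Dp A11 \<alpha> y))"
    show ?thesis
      by (rule S_bound_A11_generator[OF comp gen[unfolded A11_def] \<alpha>(1)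
            \<alpha>(2)[unfolded A11_def A21_def] that]) simp
  qed
  have "nonneg_subspace P L"
    using L_max unfolding max_nonneg_subspace_def by (rule conjunct1)
  then have L_sub: "csubspace L" and L_nn: "\<And>x. x \<in> L \<Longrightarrow> 0 \<le> Re (cinner (Jop P x) x)"
    by (simp_all add: nonneg_subspace_def)
  \<comment> \<open>Nonnegativity of the form at \<open>x\<close> says exactly |Q x|^2 \<le> |P
    x|^2.\<close>
  have QP: "norm (Q x) \<le> norm (P x)" if "x \<in> L" for x
    using L_nn[OF that] unfolding Re_cinner_Jop[OF proj] by (intro power2_le_imp_le[OF _ norm_ge_zero]) linarith
  \<comment> \<open>Membership in \<open>Dbar\<close> provides some value over \<open>x\<close>, so
    the chosen value is a genuine point of the closed graph.\<close>
  have graph: "(x, Abar x) \<in> closure (op_graph {x + y | x y. x \<in> Dp \<and> y \<in> Dm} A)"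
    if "x \<in> Dbar" for x
    using that unfolding Dbar_def Abar_def closure_dom_def closure_fun_def mem_Collect_eq
    by (rule someI_ex)
  have "clinear_on Dbar Abar"
    by (rule clinear_on_of_Jop[OF proj J_m_diss[unfolded m_dissipative_def, THEN conjunct1]])
  then have lin_L: "clinear_on (Dbar \<inter> L) Abar"
    by (rule clinear_on_Int[OF _ L_sub])
  show ?thesis
  proof (rule generates_qh_semigroup_of_large_bound[OF lin_L max_nonneg_subspace_closed[OF proj L_max]])
    show "Dbar \<inter> L \<subseteq> L" "L \<subseteq> closure (Dbar \<inter> L)" "Abar ` (Dbar \<inter> L) \<subseteq> L"
      using L_inv by (auto simp: op_invariant_def)
    show "in_resolvent L (Dbar \<inter> L) Abar l" if "0 < Re l" for l using spec that by simp
    fix \<epsilon> :: real assume \<epsilon>: "0 < \<epsilon>"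
    obtain r C where C: "0 \<le> C" and
      bound: "\<forall>x y l. (x, y) \<in> closure (op_graph {x + y | x y. x \<in> Dp \<and> y \<in> Dm} A) \<longrightarrow>
          norm (Q x) \<le> norm (P x) \<longrightarrow> \<epsilon> < Re l \<longrightarrow> r \<le> cmod l \<longrightarrow>
          cmod l * norm x \<le> C * norm (y - scaleC l x)"
      using large_resolvent_bound[OF Sb[OF \<epsilon>]] by (elim exE conjE)
    have "cmod l * norm x \<le> C * norm (Abar x - scaleC l x)"
      if x: "x \<in> Dbar \<inter> L" and l: "\<epsilon> < Re l" "r \<le> cmod l" for x l
      by (rule bound[rule_format, OF graph[OF IntD1[OF x]] QP[OF IntD2[OF x]] l])
    with C show "\<exists>r C. 0 \<le> C \<and> (\<forall>x\<in>Dbar \<inter> L. \<forall>l. \<epsilon> < Re l \<longrightarrow>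
        r \<le> cmod l \<longrightarrow> cmod l * norm x \<le> C * norm (Abar x - scaleC l x))"
      by (intro exI[of _ r] exI[of _ C] conjI ballI allI impI)
  qed
qed

end
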